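(* Let $\mathbb G$ and $\mathbb H$ be two quantum permutation groups with commutative $C^*$-algebras $C(\mathbb G)$ and $C(\mathbb H)$. Then their free product $\mathbb G*\mathbb H$ has no nonlocal symmetry.
   Context: A magic unitary is a matrix $U=(u_{ij})\in M_n(\mathcal A)$ over a unital $C^*$-algebra $\mathcal A$ with $u_{ij}=u_{ij}^*=u_{ij}^2$ and $\sum_ku_{ik}=\sum_ku_{ki}=\mathbf 1$ for all $i,j$. A compact matrix quantum group is a pair $\mathbb G=(C(\mathbb G),U)$ with $C(\mathbb G)$ a unital $C^*$-algebra generated by the entries of $U=(u_{ij})\in M_n(C(\mathbb G))$ (the fundamental representation), such that there is a $*$-homomorphism $C(\mathbb G)\to C(\mathbb G)\otimes C(\mathbb G)$ (minimal tensor product) with $u_{ij}\mapsto\sum_ku_{ik}\otimes u_{kj}$, and $U$, $U^T$ are invertible. A quantum permutation group is a quantum subgroup of the quantum symmetric group $S_n^+$, i.e. a compact matrix quantum group whose fundamental representation $U$ is a magic unitary. A quantum permutation group $\mathbb G$ with fundamental representation $U\in M_n(C(\mathbb G))$ exhibits (has) nonlocal symmetry if there is a tracial state $\tau$ on $C(\mathbb G)$ such that the correlation $p(l,k|i,j)=\tau(u_{il}u_{jk})$ is nonlocal (non-classical), i.e. not a convex combination of the correlations $p_\pi$, $\pi\in S_n$, where $p_\pi(l,k|i,j)=1$ if $l=\pi(i)$ and $k=\pi(j)$, and $0$ otherwise. For $\mathbb G=(C(\mathbb G),U)$ and $\mathbb H=(C(\mathbb H),V)$ quantum permutation groups, the free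 product is $\mathbb G*\mathbb H=(C(\mathbb G)*C(\mathbb H),U\oplus V)$, where $C(\mathbb G)*C(\mathbb H)$ is the universal $C^*$-algebra with generators $u_{ij},v_{kl}$ fulfilling the relations of $C(\mathbb G)$ and $C(\mathbb H)$ respectively, with $\mathbf 1_{C(\mathbb G)}=\mathbf 1_{C(\mathbb H)}$. *)

theory Defs
  imports
    Complex_Main
    "HOL-Algebra.Subrings"
    "HOL-Combinatorics.Permutations"
    "HOL-Library.Nonpos_Ints"
begin

section \<open>Unital $C^*$-algebras\<close>

record 'a star_alg = "(complex, 'a) module" +
  star :: "'a \<Rightarrow> 'a"

record 'a normed_star_alg = "'a star_alg" +
  nrm :: "'a \<Rightarrow> real"

locale star_algebra = ring A for A :: "('a, 'z) star_alg_scheme" (structure) +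
  assumes smult_closed: "x \<in> carrier A \<Longrightarrow> c \<odot> x \<in> carrier A"
    and smult_add_left: "x \<in> carrier A \<Longrightarrow> (c + d) \<odot> x = c \<odot> x \<oplus> d \<odot> x"
    and smult_add_right: "\<lbrakk>x \<in> carrier A; y \<in> carrier A\<rbrakk> \<Longrightarrow> c \<odot> (x \<oplus> y) = c \<odot> x \<oplus> c \<odot> y"
    and smult_assoc: "x \<in> carrier A \<Longrightarrow> (c * d) \<odot> x = c \<odot> (d \<odot> x)"
    and smult_one: "x \<in> carrier A \<Longrightarrow> 1 \<odot> x = x"
    and smult_mult_left: "\<lbrakk>x \<in> carrier A; y \<in> carrier A\<rbrakk> \<Longrightarrow> (c \<odot> x) \<otimes> y = c \<odot> (x \<otimes> y)"
    and smult_mult_right: "\<lbrakk>x \<in> carrier A; y \<in> carrier A\<rbrakk> \<Longrightarrow> x \<otimes> (c \<odot> y) = c \<odot> (x \<otimes> y)"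
    and star_closed: "x \<in> carrier A \<Longrightarrow> star A x \<in> carrier A"
    and star_add: "\<lbrakk>x \<in> carrier A; y \<in> carrier A\<rbrakk> \<Longrightarrow> star A (x \<oplus> y) = star A x \<oplus> star A y"
    and star_smult: "x \<in> carrier A \<Longrightarrow> star A (c \<odot> x) = cnj c \<odot> star A x"
    and star_mult: "\<lbrakk>x \<in> carrier A; y \<in> carrier A\<rbrakk> \<Longrightarrow> star A (x \<otimes> y) = star A y \<otimes> star A x"
    and star_star: "x \<in> carrier A \<Longrightarrow> star A (star A x) = x"

definition cstar_seminorm :: "('a, 'z) star_alg_scheme \<Rightarrow> ('a \<Rightarrow> real) \<Rightarrow> bool" where
  "cstar_seminorm A q \<longleftrightarrow>
     (\<forall>x\<in>carrier A. 0 \<le> q x) \<and>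
     (\<forall>x\<in>carrier A. \<forall>y\<in>carrier A. q (x \<oplus>\<^bsub>A\<^esub> y) \<le> q x + q y) \<and>
     (\<forall>c. \<forall>x\<in>carrier A. q (c \<odot>\<^bsub>A\<^esub> x) = cmod c * q x) \<and>
     (\<forall>x\<in>carrier A. \<forall>y\<in>carrier A. q (x \<otimes>\<^bsub>A\<^esub> y) \<le> q x * q y) \<and>
     (\<forall>x\<in>carrier A. q (star A x \<otimes>\<^bsub>A\<^esub> x) = (q x)\<^sup>2)"

definition cauchy_seqs :: "('a, 'z) star_alg_scheme \<Rightarrow> ('a \<Rightarrow> real) \<Rightarrow> (nat \<Rightarrow> 'a) set" where
  "cauchy_seqs A q = {x. (\<forall>k. x k \<in> carrier A) \<and>
     (\<forall>e>0. \<exists>N. \<forall>k\<ge>N. \<forall>l\<ge>N. q (x k \<ominus>\<^bsub>A\<^esub> x l) < e)}"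

locale cstar_algebra = star_algebra A for A :: "('a, 'z) normed_star_alg_scheme" (structure) +
  assumes nrm_cstar_seminorm: "cstar_seminorm A (nrm A)"
    and nrm_eq_zero: "\<lbrakk>x \<in> carrier A; nrm A x = 0\<rbrakk> \<Longrightarrow> x = \<zero>"
    and nrm_complete: "s \<in> cauchy_seqs A (nrm A) \<Longrightarrow>
          \<exists>l\<in>carrier A. (\<lambda>k. nrm A (s k \<ominus> l)) \<longlonglongrightarrow> 0"

definition star_hom ::
  "('a, 'y) star_alg_scheme \<Rightarrow> ('b, 'z) star_alg_scheme \<Rightarrow> ('a \<Rightarrow> 'b) set" where
  "star_hom A B = {f \<in> ring_hom A B.
     (\<forall>c. \<forall>x\<in>carrier A. f (c \<odot>\<^bsub>A\<^esub> x) = c \<odot>\<^bsub>B\<^esub> f x) \<and>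
     (\<forall>x\<in>carrier A. f (star A x) = star B (f x))}"

definition closed_star_subalgebra :: "'a set \<Rightarrow> ('a, 'z) normed_star_alg_scheme \<Rightarrow> bool" where
  "closed_star_subalgebra S A \<longleftrightarrow> subring S A \<and>
     (\<forall>c. \<forall>x\<in>S. c \<odot>\<^bsub>A\<^esub> x \<in> S) \<and> (\<forall>x\<in>S. star A x \<in> S) \<and>
     (\<forall>s l. (\<forall>k. s k \<in> S) \<and> l \<in> carrier A \<and> (\<lambda>k. nrm A (s k \<ominus>\<^bsub>A\<^esub> l)) \<longlonglongrightarrow> 0 \<longrightarrow> l \<in> S)"

definition cstar_generated :: "('a, 'z) normed_star_alg_scheme \<Rightarrow> 'a set \<Rightarrow> 'a set" where
  "cstar_generated A X = \<Inter>{S. closed_star_subalgebra S A \<and> X \<subseteq> S}"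

definition tracial_state :: "('a, 'z) star_alg_scheme \<Rightarrow> ('a \<Rightarrow> complex) \<Rightarrow> bool" where
  "tracial_state A \<tau> \<longleftrightarrow>
     (\<forall>x\<in>carrier A. \<forall>y\<in>carrier A. \<tau> (x \<oplus>\<^bsub>A\<^esub> y) = \<tau> x + \<tau> y) \<and>
     (\<forall>c. \<forall>x\<in>carrier A. \<tau> (c \<odot>\<^bsub>A\<^esub> x) = c * \<tau> x) \<and>
     (\<forall>x\<in>carrier A. \<tau> (star A x \<otimes>\<^bsub>A\<^esub> x) \<in> \<real>\<^sub>\<ge>\<^sub>0) \<and>
     \<tau> \<one>\<^bsub>A\<^esub> = 1 \<and>
     (\<forall>x\<in>carrier A. \<forall>y\<in>carrier A. \<tau> (x \<otimes>\<^bsub>A\<^esub> y) = \<tau> (y \<otimes>\<^bsub>A\<^esub> x))"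

section \<open>Completion of a $*$-algebra with respect to a $C^*$-seminorm\<close>

text \<open>Separation and completion in one step: points are classes of Cauchy sequences whose
  difference tends to zero in the seminorm, so elements of seminorm zero become zero.\<close>

definition null_diff_rel ::
  "('a, 'z) star_alg_scheme \<Rightarrow> ('a \<Rightarrow> real) \<Rightarrow> ((nat \<Rightarrow> 'a) \<times> (nat \<Rightarrow> 'a)) set" where
  "null_diff_rel A q = {(x, y). x \<in> cauchy_seqs A q \<and> y \<in> cauchy_seqs A q \<and>
     (\<lambda>k. q (x k \<ominus>\<^bsub>A\<^esub> y k)) \<longlonglongrightarrow> 0}"

definition seq_class ::
  "('a, 'z) star_alg_scheme \<Rightarrow> ('a \<Rightarrow> real) \<Rightarrow> (nat \<Rightarrow> 'a) \<Rightarrow> (nat \<Rightarrow> 'a) set" where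
  "seq_class A q x = null_diff_rel A q `` {x}"

definition class_rep :: "(nat \<Rightarrow> 'a) set \<Rightarrow> nat \<Rightarrow> 'a" where
  "class_rep X = (SOME x. x \<in> X)"

definition cstar_completion ::
  "('a, 'z) star_alg_scheme \<Rightarrow> ('a \<Rightarrow> real) \<Rightarrow> (nat \<Rightarrow> 'a) set normed_star_alg" where
  "cstar_completion A q = \<lparr>
     carrier = cauchy_seqs A q // null_diff_rel A q,
     monoid.mult = (\<lambda>X Y. seq_class A q (\<lambda>k. class_rep X k \<otimes>\<^bsub>A\<^esub> class_rep Y k)),
     one = seq_class A q (\<lambda>_. \<one>\<^bsub>A\<^esub>),
     zero = seq_class A q (\<lambda>_. \<zero>\<^bsub>A\<^esub>),
     add = (\<lambda>X Y. seq_class A q (\<lambda>k. class_rep X k \<oplus>\<^bsub>A\<^esub> class_rep Y k)),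
     smult = (\<lambda>c X. seq_class A q (\<lambda>k. c \<odot>\<^bsub>A\<^esub> class_rep X k)),
     star = (\<lambda>X. seq_class A q (\<lambda>k. star A (class_rep X k))),
     nrm = (\<lambda>X. lim (\<lambda>k. q (class_rep X k)))\<rparr>"

definition completion_embed ::
  "('a, 'z) star_alg_scheme \<Rightarrow> ('a \<Rightarrow> real) \<Rightarrow> 'a \<Rightarrow> (nat \<Rightarrow> 'a) set" where
  "completion_embed A q x = seq_class A q (\<lambda>_. x)"

section \<open>Monoid $*$-algebras\<close>

definition support :: "('m \<Rightarrow> complex) \<Rightarrow> 'm set" where
  "support f = {x. f x \<noteq> 0}"

text \<open>The complex monoid algebra of \<open>M\<close>, with the conjugate-linear involution extending an
  involutive anti-automorphism \<open>s\<close> of \<open>M\<close>.\<close>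

definition monoid_star_algebra ::
  "('m, 'z) monoid_scheme \<Rightarrow> ('m \<Rightarrow> 'm) \<Rightarrow> ('m \<Rightarrow> complex) star_alg" where
  "monoid_star_algebra M s = \<lparr>
     carrier = {f. finite (support f) \<and> support f \<subseteq> carrier M},
     monoid.mult = (\<lambda>f g z. \<Sum>(x, y) \<in> {(x, y) \<in> support f \<times> support g. x \<otimes>\<^bsub>M\<^esub> y = z}. f x * g y),
     one = (\<lambda>z. if z = \<one>\<^bsub>M\<^esub> then 1 else 0),
     zero = (\<lambda>_. 0),
     add = (\<lambda>f g z. f z + g z),
     smult = (\<lambda>c f z. c * f z),
     star = (\<lambda>f z. if z \<in> carrier M then cnj (f (s z)) else 0)\<rparr>"

definition point_fun :: "'m \<Rightarrow> 'm \<Rightarrow> complex" where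
  "point_fun x = (\<lambda>z. if z = x then 1 else 0)"

section \<open>The minimal tensor product\<close>

text \<open>The algebraic tensor product of \<open>A\<close> and \<open>B\<close> is the algebra spanned freely by pairs
  \<open>(a, b)\<close>, with componentwise product and involution, modulo the elements on which every
  bilinear form vanishes. Its minimal (spatial) $C^*$-norm is the least of all $C^*$-norms;
  these are here regarded as $C^*$-seminorms on the free algebra having exactly that
  kernel, and the quotient is taken by the completion.\<close>

definition pair_star_algebra ::
  "('a, 'y) star_alg_scheme \<Rightarrow> ('b, 'z) star_alg_scheme \<Rightarrow> ('a \<times> 'b \<Rightarrow> complex) star_alg" where
  "pair_star_algebra A B = monoid_star_algebra (A \<times>\<times> B) (map_prod (star A) (star B))"

definition bilinear_form ::
  "('a, 'y) star_alg_scheme \<Rightarrow> ('b, 'z) star_alg_scheme \<Rightarrow> ('a \<Rightarrow> 'b \<Rightarrow> complex) \<Rightarrow> bool" where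
  "bilinear_form A B \<beta> \<longleftrightarrow>
     (\<forall>x\<in>carrier A. \<forall>x'\<in>carrier A. \<forall>y\<in>carrier B. \<beta> (x \<oplus>\<^bsub>A\<^esub> x') y = \<beta> x y + \<beta> x' y) \<and>
     (\<forall>x\<in>carrier A. \<forall>y\<in>carrier B. \<forall>y'\<in>carrier B. \<beta> x (y \<oplus>\<^bsub>B\<^esub> y') = \<beta> x y + \<beta> x y') \<and>
     (\<forall>c. \<forall>x\<in>carrier A. \<forall>y\<in>carrier B.
        \<beta> (c \<odot>\<^bsub>A\<^esub> x) y = c * \<beta> x y \<and> \<beta> x (c \<odot>\<^bsub>B\<^esub> y) = c * \<beta> x y)"

definition tensor_kernel ::
  "('a, 'y) star_alg_scheme \<Rightarrow> ('b, 'z) star_alg_scheme \<Rightarrow> ('a \<times> 'b \<Rightarrow> complex) set" where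
  "tensor_kernel A B = {t \<in> carrier (pair_star_algebra A B).
     \<forall>\<beta>. bilinear_form A B \<beta> \<longrightarrow> (\<Sum>(a, b) \<in> support t. t (a, b) * \<beta> a b) = 0}"

definition min_tensor_norm ::
  "('a, 'y) star_alg_scheme \<Rightarrow> ('b, 'z) star_alg_scheme \<Rightarrow> ('a \<times> 'b \<Rightarrow> complex) \<Rightarrow> real" where
  "min_tensor_norm A B t = Inf {q t | q. cstar_seminorm (pair_star_algebra A B) q \<and>
     {s \<in> carrier (pair_star_algebra A B). q s = 0} = tensor_kernel A B}"

definition min_tensor ::
  "('a, 'y) star_alg_scheme \<Rightarrow> ('b, 'z) star_alg_scheme
     \<Rightarrow> (nat \<Rightarrow> 'a \<times> 'b \<Rightarrow> complex) set normed_star_alg" where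
  "min_tensor A B = cstar_completion (pair_star_algebra A B) (min_tensor_norm A B)"

definition elem_tensor ::
  "('a, 'y) star_alg_scheme \<Rightarrow> ('b, 'z) star_alg_scheme
     \<Rightarrow> 'a \<Rightarrow> 'b \<Rightarrow> (nat \<Rightarrow> 'a \<times> 'b \<Rightarrow> complex) set" where
  "elem_tensor A B a b =
     completion_embed (pair_star_algebra A B) (min_tensor_norm A B) (point_fun (a, b))"

section \<open>Quantum permutation groups\<close>

text \<open>An $n \times n$ matrix is a function of two indices below \<open>n\<close>; its values at other
  indices are irrelevant.\<close>

definition invertible_matrix ::
  "('a, 'z) star_alg_scheme \<Rightarrow> nat \<Rightarrow> (nat \<Rightarrow> nat \<Rightarrow> 'a) \<Rightarrow> bool" where
  "invertible_matrix A n u \<longleftrightarrow>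
     (\<exists>w. (\<forall>i<n. \<forall>j<n. w i j \<in> carrier A) \<and>
       (\<forall>i<n. \<forall>j<n.
          (\<Oplus>\<^bsub>A\<^esub>k\<in>{..<n}. u i k \<otimes>\<^bsub>A\<^esub> w k j) = (if i = j then \<one>\<^bsub>A\<^esub> else \<zero>\<^bsub>A\<^esub>) \<and>
          (\<Oplus>\<^bsub>A\<^esub>k\<in>{..<n}. w i k \<otimes>\<^bsub>A\<^esub> u k j) = (if i = j then \<one>\<^bsub>A\<^esub> else \<zero>\<^bsub>A\<^esub>)))"

definition magic_unitary ::
  "('a, 'z) star_alg_scheme \<Rightarrow> nat \<Rightarrow> (nat \<Rightarrow> nat \<Rightarrow> 'a) \<Rightarrow> bool" where
  "magic_unitary A n u \<longleftrightarrow>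
     (\<forall>i<n. \<forall>j<n. u i j \<in> carrier A \<and> star A (u i j) = u i j \<and> u i j \<otimes>\<^bsub>A\<^esub> u i j = u i j) \<and>
     (\<forall>i<n. (\<Oplus>\<^bsub>A\<^esub>k\<in>{..<n}. u i k) = \<one>\<^bsub>A\<^esub> \<and> (\<Oplus>\<^bsub>A\<^esub>k\<in>{..<n}. u k i) = \<one>\<^bsub>A\<^esub>)"

record 'a matrix_qgroup =
  fun_alg :: "'a normed_star_alg"
  fund_dim :: nat
  fund_rep :: "nat \<Rightarrow> nat \<Rightarrow> 'a"

definition compact_matrix_quantum_group :: "('a, 'z) matrix_qgroup_scheme \<Rightarrow> bool" where
  "compact_matrix_quantum_group G \<longleftrightarrow>
     (let A = fun_alg G; n = fund_dim G; u = fund_rep G in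
       cstar_algebra A \<and>
       (\<forall>i<n. \<forall>j<n. u i j \<in> carrier A) \<and>
       cstar_generated A {u i j | i j. i < n \<and> j < n} = carrier A \<and>
       (\<exists>\<Delta> \<in> star_hom A (min_tensor A A). \<forall>i<n. \<forall>j<n.
          \<Delta> (u i j) = (\<Oplus>\<^bsub>min_tensor A A\<^esub>k\<in>{..<n}. elem_tensor A A (u i k) (u k j))) \<and>
       invertible_matrix A n u \<and>
       invertible_matrix A n (\<lambda>i j. u j i))"

definition quantum_permutation_group :: "('a, 'z) matrix_qgroup_scheme \<Rightarrow> bool" where
  "quantum_permutation_group G \<longleftrightarrow> compact_matrix_quantum_group G \<and>
     magic_unitary (fun_alg G) (fund_dim G) (fund_rep G)"

section \<open>Nonlocal symmetry\<close>

text \<open>A correlation \<open>p\<close> is written with arguments in the order \<open>p l k i j\<close> for $p(l,k|i,j)$.\<close>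

definition perm_correlation :: "(nat \<Rightarrow> nat) \<Rightarrow> nat \<Rightarrow> nat \<Rightarrow> nat \<Rightarrow> nat \<Rightarrow> real" where
  "perm_correlation \<pi> l k i j = (if l = \<pi> i \<and> k = \<pi> j then 1 else 0)"

definition local_correlation ::
  "nat \<Rightarrow> (nat \<Rightarrow> nat \<Rightarrow> nat \<Rightarrow> nat \<Rightarrow> complex) \<Rightarrow> bool" where
  "local_correlation n p \<longleftrightarrow>
     (\<exists>c :: (nat \<Rightarrow> nat) \<Rightarrow> real.
       (\<forall>\<pi>. \<pi> permutes {..<n} \<longrightarrow> 0 \<le> c \<pi>) \<and>
       (\<Sum>\<pi> | \<pi> permutes {..<n}. c \<pi>) = 1 \<and>
       (\<forall>l<n. \<forall>k<n. \<forall>i<n. \<forall>j<n.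
          p l k i j = of_real (\<Sum>\<pi> | \<pi> permutes {..<n}. c \<pi> * perm_correlation \<pi> l k i j)))"

definition trace_correlation ::
  "('a, 'z) matrix_qgroup_scheme \<Rightarrow> ('a \<Rightarrow> complex) \<Rightarrow> nat \<Rightarrow> nat \<Rightarrow> nat \<Rightarrow> nat \<Rightarrow> complex" where
  "trace_correlation G \<tau> l k i j = \<tau> (fund_rep G i l \<otimes>\<^bsub>fun_alg G\<^esub> fund_rep G j k)"

definition has_nonlocal_symmetry :: "('a, 'z) matrix_qgroup_scheme \<Rightarrow> bool" where
  "has_nonlocal_symmetry G \<longleftrightarrow>
     (\<exists>\<tau>. tracial_state (fun_alg G) \<tau> \<and>
       \<not> local_correlation (fund_dim G) (trace_correlation G \<tau>))"

section \<open>The free product\<close>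

text \<open>The generators of \<open>fun_alg G\<close> and \<open>fun_alg H\<close> are represented by letters \<open>(i, j)\<close>, the
  indices being those of the block matrix $U \oplus V$: the letter \<open>(i, j)\<close> stands for
  $u_{ij}$ if \<open>i, j < n\<close> and for $v_{i-n,j-n}$ if \<open>n \<le> i, j < n + m\<close>. All of these
  generators are self-adjoint, so noncommutative polynomials in the letters, with the
  involution that reverses words, suffice to form the free $*$-algebra.\<close>

type_synonym letter = "nat \<times> nat"

definition left_letters :: "nat \<Rightarrow> letter set" where
  "left_letters n = {..<n} \<times> {..<n}"

definition right_letters :: "nat \<Rightarrow> nat \<Rightarrow> letter set" where
  "right_letters n m = {n..<n + m} \<times> {n..<n + m}"

definition free_star_algebra :: "'l set \<Rightarrow> ('l list \<Rightarrow> complex) star_alg" where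
  "free_star_algebra L =
     monoid_star_algebra \<lparr>carrier = lists L, monoid.mult = (@), one = []\<rparr> rev"

definition poly_eval ::
  "('a, 'z) star_alg_scheme \<Rightarrow> ('l \<Rightarrow> 'a) \<Rightarrow> ('l list \<Rightarrow> complex) \<Rightarrow> 'a" where
  "poly_eval A v P =
     (\<Oplus>\<^bsub>A\<^esub>w\<in>support P. P w \<odot>\<^bsub>A\<^esub> foldr (\<lambda>l x. v l \<otimes>\<^bsub>A\<^esub> x) w \<one>\<^bsub>A\<^esub>)"

definition free_product_algebra ::
  "('a, 'y) matrix_qgroup_scheme \<Rightarrow> ('b, 'z) matrix_qgroup_scheme
     \<Rightarrow> (letter list \<Rightarrow> complex) star_alg" where
  "free_product_algebra G H =
     free_star_algebra (left_letters (fund_dim G) \<union> right_letters (fund_dim G) (fund_dim H))"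

text \<open>Elements $x_{ij}$ of a unital $C^*$-algebra fulfil the relations of \<open>fun_alg G\<close> iff
  $u_{ij} \mapsto x_{ij}$ extends to a unital $*$-homomorphism, that is, iff
  $\|P(x)\| \le \|P(u)\|$ for all polynomials $P$ (in particular $P(x) = 0$ whenever
  $P(u) = 0$). The universal norm is the supremum over all $C^*$-seminorms under which the
  letters fulfil the relations of both algebras.\<close>

definition free_product_norm ::
  "('a, 'y) matrix_qgroup_scheme \<Rightarrow> ('b, 'z) matrix_qgroup_scheme
     \<Rightarrow> (letter list \<Rightarrow> complex) \<Rightarrow> real" where
  "free_product_norm G H x =
     (let n = fund_dim G; m = fund_dim H in
       Sup {q x | q. cstar_seminorm (free_product_algebra G H) q \<and>
         (\<forall>P \<in> carrier (free_star_algebra (left_letters n)).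
            q P \<le> nrm (fun_alg G) (poly_eval (fun_alg G) (\<lambda>(i, j). fund_rep G i j) P)) \<and>
         (\<forall>P \<in> carrier (free_star_algebra (right_letters n m)).
            q P \<le> nrm (fun_alg H)
                     (poly_eval (fun_alg H) (\<lambda>(i, j). fund_rep H (i - n) (j - n)) P))})"

definition free_product ::
  "('a, 'y) matrix_qgroup_scheme \<Rightarrow> ('b, 'z) matrix_qgroup_scheme
     \<Rightarrow> (nat \<Rightarrow> letter list \<Rightarrow> complex) set matrix_qgroup" where
  "free_product G H =
     (let F = free_product_algebra G H; p = free_product_norm G H;
          n = fund_dim G; m = fund_dim H in
       \<lparr>fun_alg = cstar_completion F p,
        fund_dim = n + m,
        fund_rep = (\<lambda>i j.
          if (i, j) \<in> left_letters n \<union> right_letters n m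
          then completion_embed F p (point_fun [(i, j)])
          else \<zero>\<^bsub>cstar_completion F p\<^esub>)\<rparr>)"

end

theory Submission
  imports Defs
begin

text \<open>Let \<open>\<tau>\<close> be a tracial state on the free product. As \<open>C(G)\<close> and \<open>C(H)\<close> are commutative, a
  product \<open>e\<close> of entries of \<open>U\<close> and a product \<open>f\<close> of entries of \<open>V\<close> are projections, and
  $\tau(ef) = \tau((ef)^*(ef)) \ge 0$ by the trace property. Hence
  $(\pi,\rho) \mapsto \tau(\prod_i u_{i\pi(i)} \prod_j v_{j\rho(j)})$ is a probability distribution on
  pairs of permutations. It reproduces the correlation of \<open>\<tau>\<close>, because mixed terms $u_{il} v_{jk}$
  and $v_{jk} u_{il}$ contain only one letter of each kind.\<close>

section \<open>Local correlations from moments\<close>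

text \<open>Two commuting families are essential for positivity: the trace of a product of three
  projections need not be real, whereas a word with one left part and one right part can be rotated
  into a square. The distribution is handled through its marginals. Every set of letters gets a
  weight, and nonnegativity together with the row and column sums already forces the weight onto
  graphs of permutations. These permute all n + m indices; letters mixing the two blocks get weight
  zero, like the off-diagonal entries of U \<oplus> V, so only block-preserving permutations carry
  mass. The trace lives on a separated completion whose operations choose representatives. It is
  therefore pulled back to free polynomials, where a linear functional is just a function on words.
  The relations of C(G) and C(H) hold there modulo null elements of the universal norm, because
  every seminorm in its defining supremum is dominated by the norm of the evaluated polynomial. That
  supremum must first be shown to be finite and to be a C*-seminorm.\<close>

definition graph_on :: "nat set \<Rightarrow> (nat \<Rightarrow> nat) \<Rightarrow> (nat \<times> nat) set" where
  "graph_on R f = (\<lambda>i. (i, f i)) ` R"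

text \<open>Fixing the points outside \<open>R\<close> makes the set finite and matches the
  convention of \<open>permutes\<close>, so that permutations are exactly the injective members for
  \<open>R = {..<N}\<close>.\<close>

definition self_maps :: "nat \<Rightarrow> nat set \<Rightarrow> (nat \<Rightarrow> nat) set" where
  "self_maps N R = {f. (\<forall>i\<in>R. f i < N) \<and> (\<forall>i. i \<notin> R \<longrightarrow> f i = i)}"

lemma self_maps_empty: "self_maps N {} = {id}"
  by (auto simp: self_maps_def)

lemma self_maps_insert:
  assumes "x \<notin> R"
  shows "self_maps N (insert x R) = (\<lambda>(k, f). f(x := k)) ` ({..<N} \<times> self_maps N R)"
proof -
  have "f \<in> (\<lambda>(k, f). f(x := k)) ` ({..<N} \<times> self_maps N R)"
    if "f \<in> self_maps N (insert x R)" for f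
  proof -
    have "f = (\<lambda>(k, f). f(x := k)) (f x, f(x := x))" by simp
    moreover have "(f x, f(x := x)) \<in> {..<N} \<times> self_maps N R"
      using that assms by (auto simp: self_maps_def)
    ultimately show ?thesis by (rule image_eqI)
  qed
  then show ?thesis using assms by (auto simp: self_maps_def)
qed

lemma inj_on_self_maps_insert:
  assumes "x \<notin> R"
  shows "inj_on (\<lambda>(k, f). f(x := k)) ({..<N} \<times> self_maps N R)"
proof (rule inj_onI, clarsimp)
  fix k f l g
  assume "f \<in> self_maps N R" "g \<in> self_maps N R" and e: "f(x := k) = g(x := l)"
  then have "f x = g x" using assms by (simp add: self_maps_def)
  with e show "k = l \<and> f = g"
    by (metis fun_upd_eqD fun_upd_triv fun_upd_upd)
qed

lemma finite_self_maps: "finite R \<Longrightarrow> finite (self_maps N R)"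
  by (induction R rule: finite_induct) (auto simp: self_maps_empty self_maps_insert)

text \<open>The rows of \<open>R\<close> are summed out one at a time, and \<open>S\<close> collects
  the pairs already chosen. The row identity is required for every \<open>S\<close>, including sets
  that contain conflicting pairs, so no case distinction arises.\<close>

lemma sum_self_maps:
  fixes \<mu> :: "(nat \<times> nat) set \<Rightarrow> 'c::comm_monoid_add"
  assumes row: "\<And>S i. S \<subseteq> {..<N} \<times> {..<N} \<Longrightarrow> i < N \<Longrightarrow> (\<Sum>k<N. \<mu> (insert (i, k) S)) = \<mu> S"
    and "finite R" "R \<subseteq> {..<N}" "S \<subseteq> {..<N} \<times> {..<N}"
  shows "(\<Sum>f\<in>self_maps N R. \<mu> (graph_on R f \<union> S)) = \<mu> S"
  using assms(2-)
proof (induction R arbitrary: S rule: finite_induct)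
  case empty
  then show ?case by (simp add: self_maps_empty graph_on_def)
next
  case (insert x R)
  have "(\<Sum>f\<in>self_maps N (insert x R). \<mu> (graph_on (insert x R) f \<union> S)) =
    (\<Sum>(k, f)\<in>{..<N} \<times> self_maps N R. \<mu> (graph_on (insert x R) (f(x := k)) \<union> S))"
    unfolding self_maps_insert[OF insert.hyps(2)]
    by (subst sum.reindex[OF inj_on_self_maps_insert[OF insert.hyps(2)]])
      (simp add: comp_def case_prod_unfold)
  also have "\<dots> = (\<Sum>(k, f)\<in>{..<N} \<times> self_maps N R. \<mu> (graph_on R f \<union> insert (x, k) S))"
  proof (rule sum.cong, simp, clarify)
    fix k f
    have "graph_on (insert x R) (f(x := k)) \<union> S = graph_on R f \<union> insert (x, k) S"
      using insert.hyps unfolding graph_on_def by force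
    then show "\<mu> (graph_on (insert x R) (f(x := k)) \<union> S) = \<mu> (graph_on R f \<union> insert (x, k) S)"
      by simp
  qed
  also have "\<dots> = (\<Sum>k<N. \<Sum>f\<in>self_maps N R. \<mu> (graph_on R f \<union> insert (x, k) S))"
    by (simp add: sum.cartesian_product)
  also have "\<dots> = (\<Sum>k<N. \<mu> (insert (x, k) S))"
    using insert.prems by (intro sum.cong refl insert.IH) auto
  also have "\<dots> = \<mu> S" using insert.prems by (intro row) auto
  finally show ?case .
qed

lemma permutes_iff_self_maps:
  "\<pi> permutes {..<N} \<longleftrightarrow> \<pi> \<in> self_maps N {..<N} \<and> inj_on \<pi> {..<N}"
proof
  assume "\<pi> permutes {..<N}"
  then show "\<pi> \<in> self_maps N {..<N} \<and> inj_on \<pi> {..<N}"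
    by (auto simp: self_maps_def permutes_inj_on dest: permutes_in_image permutes_not_in)
next
  assume a: "\<pi> \<in> self_maps N {..<N} \<and> inj_on \<pi> {..<N}"
  then have "\<pi> ` {..<N} \<subseteq> {..<N}" by (auto simp: self_maps_def)
  then have "bij_betw \<pi> {..<N} {..<N}"
    using a endo_inj_surj[of "{..<N}" \<pi>] by (simp add: bij_betw_def)
  then show "\<pi> permutes {..<N}"
    using a by (intro bij_imp_permutes) (auto simp: self_maps_def)
qed

text \<open>Think of \<open>\<mu> S\<close> as the probability that the graph of a random permutation contains \<open>S\<close>.\<close>

theorem local_correlation_of_moments:
  fixes \<mu> :: "(nat \<times> nat) set \<Rightarrow> real"
  assumes nonneg: "\<And>S. S \<subseteq> {..<N} \<times> {..<N} \<Longrightarrow> 0 \<le> \<mu> S"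
    and empty: "\<mu> {} = 1"
    and row: "\<And>S i. S \<subseteq> {..<N} \<times> {..<N} \<Longrightarrow> i < N \<Longrightarrow> (\<Sum>k<N. \<mu> (insert (i, k) S)) = \<mu> S"
    and col: "\<And>S i. S \<subseteq> {..<N} \<times> {..<N} \<Longrightarrow> i < N \<Longrightarrow> (\<Sum>k<N. \<mu> (insert (k, i) S)) = \<mu> S"
    and p: "\<And>l k i j. \<lbrakk>l < N; k < N; i < N; j < N\<rbrakk> \<Longrightarrow> p l k i j = of_real (\<mu> {(i, l), (j, k)})"
  shows "local_correlation N p"
proof -
  \<comment> \<open>Nonnegative terms whose total equals one of them leave nothing for the
    others.\<close>
  have absorb: "b = 0" if "(\<Sum>k<N. h k) = h a" "a < N" "l < N" "a \<noteq> l" "\<And>k. k < N \<Longrightarrow> 0 \<le> h k"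
    "h l = b" for h :: "nat \<Rightarrow> real" and a l b
  proof -
    have "(\<Sum>k\<in>{..<N} - {a}. h k) = 0"
      using that by (simp add: sum_diff1)
    then have "\<forall>k\<in>{..<N} - {a}. h k = 0"
      using that by (subst (asm) sum_nonneg_eq_0_iff) auto
    then show ?thesis using that by auto
  qed
  \<comment> \<open>Both pairs already lie in \<open>S\<close>, so the terms at \<open>k\<close> and
    at \<open>l\<close> of the row sum both equal \<open>\<mu> S\<close>. The term at
    \<open>k\<close> exhausts the sum, hence the one at \<open>l\<close> vanishes.\<close>
  have row_zero: "\<mu> S = 0" if "S \<subseteq> {..<N} \<times> {..<N}" "(i, k) \<in> S" "(i, l) \<in> S" "k \<noteq> l" for S i k l
  proof (rule absorb[of "\<lambda>k. \<mu> (insert (i, k) S)" k l])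
    show "(\<Sum>k<N. \<mu> (insert (i, k) S)) = \<mu> (insert (i, k) S)"
      using that row[of S i] by (auto simp: insert_absorb)
  qed (use that in \<open>auto simp: insert_absorb intro!: nonneg\<close>)
  have col_zero: "\<mu> S = 0" if "S \<subseteq> {..<N} \<times> {..<N}" "(k, i) \<in> S" "(l, i) \<in> S" "k \<noteq> l" for S i k l
  proof (rule absorb[of "\<lambda>k. \<mu> (insert (k, i) S)" k l])
    show "(\<Sum>k<N. \<mu> (insert (k, i) S)) = \<mu> (insert (k, i) S)"
      using that col[of S i] by (auto simp: insert_absorb)
  qed (use that in \<open>auto simp: insert_absorb intro!: nonneg\<close>)
  let ?F = "self_maps N {..<N}" and ?P = "{\<pi>. \<pi> permutes {..<N}}" and ?g = "graph_on {..<N}"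
  have g: "?g f \<subseteq> {..<N} \<times> {..<N}" if "f \<in> ?F" for f
    using that by (auto simp: graph_on_def self_maps_def)
  \<comment> \<open>Summing out all rows ranges over all maps. A map with a collision puts two
    letters into one column and contributes nothing, so only permutations remain.\<close>
  have expand: "\<mu> S = (\<Sum>\<pi>\<in>?P. \<mu> (?g \<pi> \<union> S))" if S: "S \<subseteq> {..<N} \<times> {..<N}" for S
  proof -
    have "\<mu> S = (\<Sum>f\<in>?F. \<mu> (?g f \<union> S))"
      using S by (subst sum_self_maps) (auto intro: row)
    also have "\<dots> = (\<Sum>\<pi>\<in>?P. \<mu> (?g \<pi> \<union> S))"
    proof (rule sum.mono_neutral_right)
      show "\<forall>f\<in>?F - ?P. \<mu> (?g f \<union> S) = 0"
      proof
        fix f assume f: "f \<in> ?F - ?P"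
        then obtain i j where "i < N" "j < N" "i \<noteq> j" "f i = f j"
          by (auto simp: permutes_iff_self_maps inj_on_def)
        then show "\<mu> (?g f \<union> S) = 0"
          using S g[of f] f by (intro col_zero[of _ i "f i" j]) (auto simp: graph_on_def)
      qed
    qed (auto simp: permutes_iff_self_maps finite_self_maps)
    finally show ?thesis .
  qed
  \<comment> \<open>The graph of a permutation has a letter in every row; adding a different one
    creates a row conflict and annihilates the moment.\<close>
  have perm: "\<mu> (?g \<pi> \<union> {(i, l), (j, k)}) = \<mu> (?g \<pi>) * perm_correlation \<pi> l k i j"
    if \<pi>: "\<pi> permutes {..<N}" and lt: "l < N" "k < N" "i < N" "j < N" for \<pi> l k i j
  proof (cases "l = \<pi> i \<and> k = \<pi> j")
    case True
    then have "?g \<pi> \<union> {(i, l), (j, k)} = ?g \<pi>" using lt by (auto simp: graph_on_def)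
    then show ?thesis using True by (simp add: perm_correlation_def)
  next
    case False
    have sub: "?g \<pi> \<union> {(i, l), (j, k)} \<subseteq> {..<N} \<times> {..<N}"
      using \<pi> g lt by (auto simp: permutes_iff_self_maps)
    from False have "\<mu> (?g \<pi> \<union> {(i, l), (j, k)}) = 0"
    proof (cases "l = \<pi> i")
      case True
      then show ?thesis
        using False sub lt by (intro row_zero[of _ j k "\<pi> j"]) (auto simp: graph_on_def)
    next
      case False
      then show ?thesis
        using sub lt by (intro row_zero[of _ i l "\<pi> i"]) (auto simp: graph_on_def)
    qed
    then show ?thesis using False by (auto simp: perm_correlation_def)
  qed
  show ?thesis
    unfolding local_correlation_def
  proof (intro exI[of _ "\<lambda>\<pi>. \<mu> (?g \<pi>)"] conjI allI impI)
    show "0 \<le> \<mu> (?g \<pi>)" if "\<pi> permutes {..<N}" for \<pi>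
      using that g by (auto simp: permutes_iff_self_maps intro!: nonneg)
    show "(\<Sum>\<pi>\<in>?P. \<mu> (?g \<pi>)) = 1"
      using expand[of "{}"] empty by simp
    show "p l k i j = of_real (\<Sum>\<pi>\<in>?P. \<mu> (?g \<pi>) * perm_correlation \<pi> l k i j)"
      if "l < N" "k < N" "i < N" "j < N" for l k i j
      using that by (simp add: p expand[of "{(i, l), (j, k)}"] perm del: Un_insert_right)
  qed
qed

section \<open>Monoid $*$-algebras\<close>

text \<open>The linear functional on the monoid algebra with values \<open>\<phi>\<close> on the
  basis. Elements are compared through all such functionals, which avoids computing with convolution
  sums.\<close>

definition lin :: "('m \<Rightarrow> complex) \<Rightarrow> ('m \<Rightarrow> complex) \<Rightarrow> complex" where
  "lin \<phi> f = (\<Sum>x\<in>support f. f x * \<phi> x)"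

lemma lin_superset: "finite S \<Longrightarrow> support f \<subseteq> S \<Longrightarrow> lin \<phi> f = (\<Sum>x\<in>S. f x * \<phi> x)"
  unfolding lin_def by (rule sum.mono_neutral_left) (auto simp: support_def)

lemma lin_cong: "(\<And>x. x \<in> support f \<Longrightarrow> \<phi> x = \<psi> x) \<Longrightarrow> lin \<phi> f = lin \<psi> f"
  by (simp add: lin_def)

lemma support_point_fun: "support (point_fun x) = {x}"
  by (auto simp: support_def point_fun_def)

lemma lin_point_fun: "lin \<phi> (point_fun x) = \<phi> x"
  by (simp add: lin_def support_point_fun) (simp add: point_fun_def)

lemma support_add: "support (\<lambda>z. f z + g z) \<subseteq> support f \<union> support g"
  by (auto simp: support_def)

lemma support_scale: "support (\<lambda>z. c * f z) \<subseteq> support f"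
  by (auto simp: support_def)

lemma lin_add:
  assumes "finite (support f)" "finite (support g)"
  shows "lin \<phi> (\<lambda>z. f z + g z) = lin \<phi> f + lin \<phi> g"
  using assms support_add[of f g]
  by (simp add: lin_superset[of "support f \<union> support g"] sum.distrib distrib_right)

lemma lin_scale:
  assumes "finite (support f)"
  shows "lin \<phi> (\<lambda>z. c * f z) = c * lin \<phi> f"
  using assms support_scale[of c f]
  by (simp add: lin_superset[of "support f"] sum_distrib_left mult.assoc)

lemma lin_add_fun: "lin (\<lambda>x. \<phi> x + \<psi> x) f = lin \<phi> f + lin \<psi> f"
  by (simp add: lin_def sum.distrib distrib_left)

lemma lin_scale_fun: "lin (\<lambda>x. c * \<phi> x) f = c * lin \<phi> f"
  by (simp add: lin_def sum_distrib_left mult.left_commute)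

lemma lin_eqI:
  fixes f g :: "'m \<Rightarrow> complex"
  assumes "finite (support f)" "finite (support g)" "\<And>\<phi>. lin \<phi> f = lin \<phi> g"
  shows "f = g"
proof
  fix z
  \<comment> \<open>Testing with the indicator of \<open>z\<close> reads off the coefficient at
    \<open>z\<close>, which may lie outside the support and is therefore inserted into the summation
    range.\<close>
  have *: "lin (\<lambda>x. if x = z then 1 else 0) h = h z" if "finite (support h)" for h :: "'m \<Rightarrow> complex"
    using that by (subst lin_superset[of "insert z (support h)"])
      (auto simp: if_distrib cong: if_cong)
  show "f z = g z" using assms * by metis
qed

locale involutive_monoid = monoid M for M :: "('m, 'z) monoid_scheme" (structure) +
  fixes s :: "'m \<Rightarrow> 'm"
  assumes s_closed: "x \<in> carrier M \<Longrightarrow> s x \<in> carrier M"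
    and s_mult: "x \<in> carrier M \<Longrightarrow> y \<in> carrier M \<Longrightarrow> s (x \<otimes> y) = s y \<otimes> s x"
    and s_s: "x \<in> carrier M \<Longrightarrow> s (s x) = x"
begin

abbreviation "F \<equiv> monoid_star_algebra M s"

lemma mem_F: "f \<in> carrier F \<longleftrightarrow> finite (support f) \<and> support f \<subseteq> carrier M"
  by (simp add: monoid_star_algebra_def)

lemma add_F: "f \<oplus>\<^bsub>F\<^esub> g = (\<lambda>z. f z + g z)"
  and smult_F: "c \<odot>\<^bsub>F\<^esub> f = (\<lambda>z. c * f z)"
  and zero_F: "\<zero>\<^bsub>F\<^esub> = (\<lambda>_. 0)"
  and one_F: "\<one>\<^bsub>F\<^esub> = point_fun \<one>"
  by (simp_all add: monoid_star_algebra_def point_fun_def fun_eq_iff)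

lemma support_zero: "support (\<lambda>_. 0) = {}"
  by (simp add: support_def)

lemma lin_zero: "lin \<phi> \<zero>\<^bsub>F\<^esub> = 0"
  by (simp add: zero_F lin_def support_zero)

lemma point_closed: "x \<in> carrier M \<Longrightarrow> point_fun x \<in> carrier F"
  by (simp add: mem_F support_point_fun)

lemma add_closed_F: "f \<in> carrier F \<Longrightarrow> g \<in> carrier F \<Longrightarrow> f \<oplus>\<^bsub>F\<^esub> g \<in> carrier F"
  using support_add[of f g] by (auto simp: mem_F add_F dest: finite_subset)

lemma smult_closed_F: "f \<in> carrier F \<Longrightarrow> c \<odot>\<^bsub>F\<^esub> f \<in> carrier F"
  using support_scale[of c f] by (auto simp: mem_F smult_F dest: finite_subset)

lemma lin_add_F: "f \<in> carrier F \<Longrightarrow> g \<in> carrier F \<Longrightarrow> lin \<phi> (f \<oplus>\<^bsub>F\<^esub> g) = lin \<phi> f + lin \<phi> g"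
  by (simp add: mem_F add_F lin_add)

lemma lin_smult_F: "f \<in> carrier F \<Longrightarrow> lin \<phi> (c \<odot>\<^bsub>F\<^esub> f) = c * lin \<phi> f"
  by (simp add: mem_F smult_F lin_scale)

lemma support_mult_F:
  "support (f \<otimes>\<^bsub>F\<^esub> g) \<subseteq> (\<lambda>(x, y). x \<otimes> y) ` (support f \<times> support g)"
proof
  fix z assume "z \<in> support (f \<otimes>\<^bsub>F\<^esub> g)"
  then have "(\<Sum>(x, y) \<in> {(x, y) \<in> support f \<times> support g. x \<otimes> y = z}. f x * g y) \<noteq> 0"
    by (simp add: monoid_star_algebra_def support_def)
  then have "{(x, y) \<in> support f \<times> support g. x \<otimes> y = z} \<noteq> {}"
    by (metis sum.empty)
  then show "z \<in> (\<lambda>(x, y). x \<otimes> y) ` (support f \<times> support g)" by force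
qed

lemma mult_closed_F:
  assumes "f \<in> carrier F" "g \<in> carrier F"
  shows "f \<otimes>\<^bsub>F\<^esub> g \<in> carrier F"
proof -
  have "(\<lambda>(x, y). x \<otimes> y) ` (support f \<times> support g) \<subseteq> carrier M"
    using assms by (auto simp: mem_F)
  then show ?thesis
    using assms support_mult_F[of f g] by (auto simp: mem_F intro: finite_subset)
qed

text \<open>Grouping the pairs of support elements by their product undoes the convolution and
  leaves an iterated evaluation.\<close>

lemma lin_mult_F:
  assumes f: "f \<in> carrier F" and g: "g \<in> carrier F"
  shows "lin \<phi> (f \<otimes>\<^bsub>F\<^esub> g) = lin (\<lambda>x. lin (\<lambda>y. \<phi> (x \<otimes> y)) g) f"
proof -
  let ?m = "\<lambda>(x, y). x \<otimes> y" and ?P = "support f \<times> support g"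
  have fin: "finite ?P" using f g by (simp add: mem_F)
  have "lin \<phi> (f \<otimes>\<^bsub>F\<^esub> g) = (\<Sum>z\<in>?m ` ?P. (f \<otimes>\<^bsub>F\<^esub> g) z * \<phi> z)"
    using fin support_mult_F[of f g] by (intro lin_superset) auto
  also have "\<dots> = (\<Sum>z\<in>?m ` ?P. \<Sum>p\<in>{p \<in> ?P. ?m p = z}. f (fst p) * g (snd p) * \<phi> (?m p))"
    by (intro sum.cong refl)
       (auto simp: monoid_star_algebra_def sum_distrib_right case_prod_unfold intro!: sum.cong)
  also have "\<dots> = (\<Sum>p\<in>?P. f (fst p) * g (snd p) * \<phi> (?m p))"
    using fin by (intro sum.group) auto
  also have "\<dots> = lin (\<lambda>x. lin (\<lambda>y. \<phi> (x \<otimes> y)) g) f"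
    by (simp add: lin_def sum.cartesian_product sum_distrib_left case_prod_unfold mult.assoc)
  finally show ?thesis .
qed

lemma star_closed_F:
  assumes "f \<in> carrier F" shows "star F f \<in> carrier F"
proof -
  have "support (star F f) \<subseteq> s ` support f"
    by (auto simp: support_def monoid_star_algebra_def s_s intro!: image_eqI[of _ s "s _"])
  moreover have "support (star F f) \<subseteq> carrier M"
    by (auto simp: support_def monoid_star_algebra_def)
  ultimately show ?thesis using assms by (auto simp: mem_F dest: finite_subset)
qed

lemma lin_star_F:
  assumes f: "f \<in> carrier F"
  shows "lin \<phi> (star F f) = cnj (lin (\<lambda>x. cnj (\<phi> (s x))) f)"
proof -
  have inj: "inj_on s (support f)"
    using f by (metis inj_on_def mem_F s_s subsetD)
  have "support (star F f) \<subseteq> s ` support f"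
    by (auto simp: support_def monoid_star_algebra_def s_s intro!: image_eqI[of _ s "s _"])
  then have "lin \<phi> (star F f) = (\<Sum>z\<in>s ` support f. star F f z * \<phi> z)"
    using f by (intro lin_superset) (auto simp: mem_F)
  also have "\<dots> = (\<Sum>x\<in>support f. cnj (f x) * \<phi> (s x))"
    using f by (auto simp: sum.reindex[OF inj] mem_F monoid_star_algebra_def s_s s_closed subset_iff
        intro!: sum.cong)
  finally show ?thesis by (simp add: lin_def)
qed

lemma F_eqI:
  "f \<in> carrier F \<Longrightarrow> g \<in> carrier F \<Longrightarrow> (\<And>\<phi>. lin \<phi> f = lin \<phi> g) \<Longrightarrow> f = g"
  by (rule lin_eqI) (auto simp: mem_F)

lemma supportD: "f \<in> carrier F \<Longrightarrow> x \<in> support f \<Longrightarrow> x \<in> carrier M"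
  by (auto simp: mem_F)

lemmas F_closed = add_closed_F smult_closed_F mult_closed_F star_closed_F point_closed

lemmas lin_F = lin_add_F lin_smult_F lin_mult_F lin_star_F lin_point_fun lin_zero

text \<open>Beyond the additive group laws, each identity is tested against all functionals
  \<open>lin \<phi>\<close>. Associativity and the unit laws thereby reduce to those of the
  monoid.\<close>

lemma star_algebra_F: "star_algebra F"
proof -
  have zero: "\<zero>\<^bsub>F\<^esub> \<in> carrier F" by (simp add: mem_F zero_F support_zero)
  have one: "\<one>\<^bsub>F\<^esub> \<in> carrier F" by (simp add: one_F F_closed)
  have "abelian_group F"
  proof (rule abelian_groupI)
    fix f assume f: "f \<in> carrier F"
    show "\<exists>g\<in>carrier F. g \<oplus>\<^bsub>F\<^esub> f = \<zero>\<^bsub>F\<^esub>"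
      using f by (intro bexI[of _ "(-1) \<odot>\<^bsub>F\<^esub> f"] F_closed) (simp add: add_F smult_F zero_F)
  qed (auto simp: F_closed zero, auto simp: add_F zero_F add_ac)
  moreover have "Group.monoid F"
  proof (rule monoidI)
    fix f g h assume "f \<in> carrier F" "g \<in> carrier F" "h \<in> carrier F"
    then show "f \<otimes>\<^bsub>F\<^esub> g \<otimes>\<^bsub>F\<^esub> h = f \<otimes>\<^bsub>F\<^esub> (g \<otimes>\<^bsub>F\<^esub> h)"
      by (intro F_eqI) (auto simp: F_closed lin_F intro!: lin_cong dest!: supportD simp: m_assoc)
  next
    fix f assume f: "f \<in> carrier F"
    then show "\<one>\<^bsub>F\<^esub> \<otimes>\<^bsub>F\<^esub> f = f" "f \<otimes>\<^bsub>F\<^esub> \<one>\<^bsub>F\<^esub> = f"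
      by (auto intro!: F_eqI lin_cong simp: F_closed lin_F one_F supportD[OF f])
  qed (auto simp: F_closed one)
  ultimately have ring: "ring F"
    by (rule ringI) (auto intro!: F_eqI simp: F_closed lin_F lin_add_fun)
  have star_mult: "star F (f \<otimes>\<^bsub>F\<^esub> g) = star F g \<otimes>\<^bsub>F\<^esub> star F f"
    if "f \<in> carrier F" "g \<in> carrier F" for f g
  proof (intro F_eqI)
    fix \<phi>
    have "lin (\<lambda>x. lin (\<lambda>y. cnj (\<phi> (s (x \<otimes> y)))) g) f = lin (\<lambda>x. lin (\<lambda>y. cnj (\<phi> (s y \<otimes> s x))) g) f"
      using that by (auto intro!: lin_cong simp: s_mult supportD[OF that(1)] supportD[OF that(2)])
    \<comment> \<open>The involution reverses products, so the two finite sums have to be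
      interchanged.\<close>
    also have "\<dots> = lin (\<lambda>y. lin (\<lambda>x. cnj (\<phi> (s y \<otimes> s x))) f) g"
      unfolding lin_def by (simp add: sum_distrib_left mult_ac) (rule sum.swap)
    finally show "lin \<phi> (star F (f \<otimes>\<^bsub>F\<^esub> g)) = lin \<phi> (star F g \<otimes>\<^bsub>F\<^esub> star F f)"
      using that by (simp add: F_closed lin_F)
  qed (auto simp: that F_closed)
  have "star F (star F f) = f" if "f \<in> carrier F" for f
    using that by (intro F_eqI) (auto intro!: lin_cong simp: F_closed lin_F s_s dest: supportD)
  with ring star_mult show ?thesis
    by (intro star_algebra.intro star_algebra_axioms.intro)
      (auto intro!: F_eqI simp: F_closed lin_F lin_scale_fun algebra_simps)
qed

lemma mult_point_F:
  "x \<in> carrier M \<Longrightarrow> y \<in> carrier M \<Longrightarrow> point_fun x \<otimes>\<^bsub>F\<^esub> point_fun y = point_fun (x \<otimes> y)"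
  by (intro F_eqI) (auto simp: F_closed lin_F)

lemma star_point_F: "x \<in> carrier M \<Longrightarrow> star F (point_fun x) = point_fun (s x)"
  by (intro F_eqI) (auto simp: F_closed lin_F s_closed)

end

section \<open>The completion\<close>

context star_algebra
begin

lemma smult_zero_left: "x \<in> carrier A \<Longrightarrow> 0 \<odot> x = \<zero>"
  using smult_add_left[of x 0 0] smult_closed[of x 0] by (simp add: r_neg1 add.l_cancel_one')

lemma smult_minus_one: "x \<in> carrier A \<Longrightarrow> (-1) \<odot> x = \<ominus> x"
  using smult_add_left[of x "-1" 1] smult_zero_left[of x] smult_one[of x] smult_closed[of x "-1"]
  by (simp add: minus_equality)

end

locale cstar_seminormed = star_algebra A for A :: "('a, 'z) star_alg_scheme" (structure) +
  fixes q :: "'a \<Rightarrow> real"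
  assumes seminorm: "cstar_seminorm A q"
begin

lemma q_nonneg: "x \<in> carrier A \<Longrightarrow> 0 \<le> q x"
  and q_add: "x \<in> carrier A \<Longrightarrow> y \<in> carrier A \<Longrightarrow> q (x \<oplus> y) \<le> q x + q y"
  and q_smult: "x \<in> carrier A \<Longrightarrow> q (c \<odot> x) = cmod c * q x"
  and q_mult: "x \<in> carrier A \<Longrightarrow> y \<in> carrier A \<Longrightarrow> q (x \<otimes> y) \<le> q x * q y"
  and q_cstar: "x \<in> carrier A \<Longrightarrow> q (star A x \<otimes> x) = (q x)\<^sup>2"
  using seminorm by (auto simp: cstar_seminorm_def)

lemma q_minus: "x \<in> carrier A \<Longrightarrow> q (\<ominus> x) = q x"
  using q_smult[of x "-1"] by (simp add: smult_minus_one)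

lemma q_zero: "q \<zero> = 0"
  using q_smult[of \<zero> 0] smult_zero_left[of \<zero>] by simp

lemma q_minus_commute:
  assumes "x \<in> carrier A" "y \<in> carrier A" shows "q (x \<ominus> y) = q (y \<ominus> x)"
proof -
  have "\<ominus> (x \<ominus> y) = y \<ominus> x"
    using assms by (simp add: minus_eq minus_add a_comm)
  then show ?thesis using q_minus[of "x \<ominus> y"] assms by simp
qed

lemma q_triangle:
  assumes "x \<in> carrier A" "y \<in> carrier A" "z \<in> carrier A"
  shows "q (x \<ominus> z) \<le> q (x \<ominus> y) + q (y \<ominus> z)"
proof -
  have "x \<ominus> z = (x \<ominus> y) \<oplus> (y \<ominus> z)"
    using assms by (simp add: minus_eq a_assoc r_neg1)
  then show ?thesis using assms q_add[of "x \<ominus> y" "y \<ominus> z"] by simp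
qed

text \<open>By the C*-identity and submultiplicativity, \<open>q y * q y\<close> is at most
  \<open>q (star A y) * q y\<close>. Cancelling \<open>q y\<close> gives one inequality, and
  applying it to \<open>star A x\<close> gives the other.\<close>

lemma q_star:
  assumes "x \<in> carrier A" shows "q (star A x) = q x"
proof -
  have le: "q y \<le> q (star A y)" if y: "y \<in> carrier A" for y
  proof (cases "q y = 0")
    case False
    have "q y * q y \<le> q (star A y) * q y"
      using q_mult[of "star A y" y] y by (simp add: q_cstar star_closed power2_eq_square)
    then show ?thesis using False q_nonneg[OF y] by simp
  qed (use y q_nonneg star_closed in simp)
  show ?thesis using le[of x] le[of "star A x"] assms by (simp add: star_closed star_star)
qed

text \<open>The limit is an element of the algebra, not of its completion, and is determined only up
  to seminorm zero. This is enough because only classes of constant sequences occur.\<close>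

definition tends :: "(nat \<Rightarrow> 'a) \<Rightarrow> 'a \<Rightarrow> bool" where
  "tends t x \<longleftrightarrow> (\<forall>k. t k \<in> carrier A) \<and> x \<in> carrier A \<and> (\<lambda>k. q (t k \<ominus> x)) \<longlonglongrightarrow> 0"

lemma tendsI:
  assumes "\<And>k. t k \<in> carrier A" "x \<in> carrier A" "h \<longlonglongrightarrow> 0" "\<And>k. q (t k \<ominus> x) \<le> h k"
  shows "tends t x"
  using assms unfolding tends_def
  by (auto intro!: tendsto_sandwich[OF _ _ tendsto_const assms(3)] simp: q_nonneg)

lemma tends_const: "x \<in> carrier A \<Longrightarrow> tends (\<lambda>_. x) x"
  by (simp add: tends_def minus_eq r_neg q_zero)

lemma tends_cauchy:
  assumes "tends t x" shows "t \<in> cauchy_seqs A q"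
  unfolding cauchy_seqs_def
proof (clarsimp, intro conjI allI impI)
  show "t k \<in> carrier A" for k using assms by (simp add: tends_def)
  fix e :: real assume "0 < e"
  then have "\<forall>\<^sub>F k in sequentially. q (t k \<ominus> x) < e / 2"
    using assms by (intro order_tendstoD[where y = 0]) (auto simp: tends_def)
  then obtain N where N: "q (t k \<ominus> x) < e / 2" if "N \<le> k" for k
    by (auto simp: eventually_sequentially)
  have "q (t k \<ominus> t l) < e" if "N \<le> k" "N \<le> l" for k l
    using N[OF that(1)] N[OF that(2)] assms q_triangle[of "t k" x "t l"] q_minus_commute[of x "t l"]
    by (simp add: tends_def)
  then show "\<exists>N. \<forall>k\<ge>N. \<forall>l\<ge>N. q (t k \<ominus> t l) < e" by blast
qed

text \<open>Membership in the class of \<open>t\<close> becomes a condition on the limit alone; both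
  directions follow from the triangle inequality.\<close>

lemma tends_unique_class:
  assumes t: "tends t x" and u: "u \<in> cauchy_seqs A q"
  shows "(t, u) \<in> null_diff_rel A q \<longleftrightarrow> tends u x"
proof -
  have c: "t k \<in> carrier A" "u k \<in> carrier A" "x \<in> carrier A" for k
    using t u by (auto simp: tends_def cauchy_seqs_def)
  show ?thesis
  proof
    assume "(t, u) \<in> null_diff_rel A q"
    then have "(\<lambda>k. q (t k \<ominus> u k) + q (t k \<ominus> x)) \<longlonglongrightarrow> 0 + 0"
      using t by (intro tendsto_add) (auto simp: null_diff_rel_def tends_def)
    moreover have "q (u k \<ominus> x) \<le> q (t k \<ominus> u k) + q (t k \<ominus> x)" for k
      using c q_triangle[of "u k" "t k" x] q_minus_commute[of "u k" "t k"] by simp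
    ultimately show "tends u x"
      using c by (intro tendsI[where h = "\<lambda>k. q (t k \<ominus> u k) + q (t k \<ominus> x)"]) auto
  next
    assume a: "tends u x"
    have lim: "(\<lambda>k. q (t k \<ominus> x) + q (u k \<ominus> x)) \<longlonglongrightarrow> 0"
      using t a by (intro tendsto_add_zero) (auto simp: tends_def)
    have "q (t k \<ominus> u k) \<le> q (t k \<ominus> x) + q (u k \<ominus> x)" for k
      using c q_triangle[of "t k" x "u k"] q_minus_commute[of x "u k"] by simp
    then have "(\<lambda>k. q (t k \<ominus> u k)) \<longlonglongrightarrow> 0"
      using c by (intro tendsto_sandwich[OF _ _ tendsto_const lim]) (auto simp: q_nonneg)
    then show "(t, u) \<in> null_diff_rel A q"
      using t a by (simp add: null_diff_rel_def tends_cauchy)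
  qed
qed

lemma seq_class_tends:
  assumes "tends t x" shows "seq_class A q t = {u. tends u x}"
  using tends_unique_class[OF assms]
  by (auto simp: seq_class_def tends_cauchy) (auto simp: null_diff_rel_def)

lemma embed_eq: "x \<in> carrier A \<Longrightarrow> completion_embed A q x = {u. tends u x}"
  by (simp add: completion_embed_def seq_class_tends tends_const)

lemma tends_class_rep: "x \<in> carrier A \<Longrightarrow> tends (class_rep (completion_embed A q x)) x"
  unfolding embed_eq class_rep_def using someI[of "\<lambda>u. tends u x", OF tends_const] by simp

lemma tends_add:
  assumes "tends t x" "tends u y" shows "tends (\<lambda>k. t k \<oplus> u k) (x \<oplus> y)"
proof (rule tendsI)
  show "(\<lambda>k. q (t k \<ominus> x) + q (u k \<ominus> y)) \<longlonglongrightarrow> 0"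
    using assms by (intro tendsto_add_zero) (auto simp: tends_def)
  fix k
  have c: "t k \<in> carrier A" "u k \<in> carrier A" "x \<in> carrier A" "y \<in> carrier A"
    using assms by (auto simp: tends_def)
  have "(t k \<oplus> u k) \<ominus> (x \<oplus> y) = (t k \<ominus> x) \<oplus> (u k \<ominus> y)"
    using c by (simp add: minus_eq minus_add a_ac)
  then show "q ((t k \<oplus> u k) \<ominus> (x \<oplus> y)) \<le> q (t k \<ominus> x) + q (u k \<ominus> y)"
    using c q_add[of "t k \<ominus> x" "u k \<ominus> y"] by simp
qed (use assms in \<open>auto simp: tends_def\<close>)

lemma tends_mult:
  assumes "tends t x" "tends u y" shows "tends (\<lambda>k. t k \<otimes> u k) (x \<otimes> y)"
proof (rule tendsI)
  have c: "t k \<in> carrier A" "u k \<in> carrier A" "x \<in> carrier A" "y \<in> carrier A" for k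
    using assms by (auto simp: tends_def)
  \<comment> \<open>The bound comes from splitting t u - x y into t (u - y) + (t - x) y and
    estimating \<open>q (t k)\<close> by \<open>q (t k \<ominus> x) + q x\<close>.\<close>
  have "(\<lambda>k. (q (t k \<ominus> x) + q x) * q (u k \<ominus> y) + q (t k \<ominus> x) * q y) \<longlonglongrightarrow> (0 + q x) * 0 + 0 * q y"
    using assms by (intro tendsto_intros) (auto simp: tends_def)
  then show "(\<lambda>k. (q (t k \<ominus> x) + q x) * q (u k \<ominus> y) + q (t k \<ominus> x) * q y) \<longlonglongrightarrow> 0" by simp
  fix k
  have "(t k \<otimes> u k) \<ominus> (x \<otimes> y) = t k \<otimes> (u k \<ominus> y) \<oplus> (t k \<ominus> x) \<otimes> y"
    using c by (simp add: minus_eq l_distr r_distr r_minus l_minus a_assoc r_neg1)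
  then have "q ((t k \<otimes> u k) \<ominus> (x \<otimes> y)) \<le> q (t k \<otimes> (u k \<ominus> y)) + q ((t k \<ominus> x) \<otimes> y)"
    using c q_add by simp
  also have "\<dots> \<le> q (t k) * q (u k \<ominus> y) + q (t k \<ominus> x) * q y"
    using c by (intro add_mono q_mult) auto
  also have "q (t k) \<le> q (t k \<ominus> x) + q x"
    using c q_triangle[of "t k" x \<zero>] by (simp add: minus_eq)
  finally show "q ((t k \<otimes> u k) \<ominus> (x \<otimes> y)) \<le> (q (t k \<ominus> x) + q x) * q (u k \<ominus> y) + q (t k \<ominus> x) * q y"
    using c by (simp add: mult_right_mono q_nonneg)
qed (use assms in \<open>auto simp: tends_def\<close>)

lemma smult_diff:
  assumes "x \<in> carrier A" "y \<in> carrier A"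
  shows "c \<odot> x \<ominus> c \<odot> y = c \<odot> (x \<ominus> y)"
proof -
  have "c \<odot> (\<ominus> y) = \<ominus> (c \<odot> y)"
    using assms smult_assoc[of y c "-1"] smult_assoc[of y "-1" c]
    by (simp add: smult_minus_one[symmetric] smult_closed)
  then show ?thesis using assms by (simp add: minus_eq smult_add_right)
qed

lemma star_diff:
  assumes "x \<in> carrier A" "y \<in> carrier A"
  shows "star A x \<ominus> star A y = star A (x \<ominus> y)"
proof -
  have "star A (\<ominus> y) = \<ominus> (star A y)"
    using assms star_smult[of y "-1"] by (simp add: smult_minus_one star_closed)
  then show ?thesis using assms by (simp add: minus_eq star_add)
qed

lemma tends_smult: "tends t x \<Longrightarrow> tends (\<lambda>k. c \<odot> t k) (c \<odot> x)"
  using tendsto_mult_left[of "\<lambda>k. q (t k \<ominus> x)" 0 sequentially "cmod c"]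
  by (simp add: tends_def smult_closed smult_diff q_smult)

lemma tends_star: "tends t x \<Longrightarrow> tends (\<lambda>k. star A (t k)) (star A x)"
  by (simp add: tends_def star_closed star_diff q_star)

text \<open>The operations of the completion act on representatives picked by
  \<open>class_rep\<close>. For an embedded element, any representative tends to that element, and
  limits respect the operations, so the choice does not affect the resulting class.\<close>

lemma completion_embed_hom: "completion_embed A q \<in> star_hom A (cstar_completion A q)"
proof -
  let ?E = "completion_embed A q" and ?C = "cstar_completion A q"
  have closed: "?E x \<in> carrier ?C" if "x \<in> carrier A" for x
    using tends_cauchy[OF tends_const[OF that]]
    by (auto simp: cstar_completion_def completion_embed_def seq_class_def quotient_def)
  have mult: "?E (x \<otimes> y) = ?E x \<otimes>\<^bsub>?C\<^esub> ?E y" if "x \<in> carrier A" "y \<in> carrier A" for x y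
    using that seq_class_tends[OF tends_mult[OF tends_class_rep tends_class_rep], of x y]
    by (simp add: cstar_completion_def embed_eq)
  have add: "?E (x \<oplus> y) = ?E x \<oplus>\<^bsub>?C\<^esub> ?E y" if "x \<in> carrier A" "y \<in> carrier A" for x y
    using that seq_class_tends[OF tends_add[OF tends_class_rep tends_class_rep], of x y]
    by (simp add: cstar_completion_def embed_eq)
  have smult: "?E (c \<odot> x) = c \<odot>\<^bsub>?C\<^esub> ?E x" if "x \<in> carrier A" for c x
    using that seq_class_tends[OF tends_smult[OF tends_class_rep], of x c]
    by (simp add: cstar_completion_def embed_eq smult_closed)
  have star: "?E (star A x) = star ?C (?E x)" if "x \<in> carrier A" for x
    using that seq_class_tends[OF tends_star[OF tends_class_rep], of x]
    by (simp add: cstar_completion_def embed_eq star_closed)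
  have one: "?E \<one> = \<one>\<^bsub>?C\<^esub>"
    by (simp add: cstar_completion_def completion_embed_def)
  show ?thesis
    unfolding star_hom_def ring_hom_def by (simp add: closed mult add smult star one)
qed

text \<open>The constant sequence \<open>x\<close> also tends to zero: the completion divides out
  the kernel of the seminorm.\<close>

lemma completion_embed_null:
  assumes "x \<in> carrier A" "q x = 0"
  shows "completion_embed A q x = completion_embed A q \<zero>"
proof -
  have "tends (\<lambda>_. x) \<zero>" using assms by (simp add: tends_def minus_eq)
  then show ?thesis using assms seq_class_tends[of "\<lambda>_. x"]
    by (simp add: embed_eq completion_embed_def[of _ _ x])
qed

end

section \<open>Traces on words in two blocks of commuting letters\<close>

text \<open>\<open>\<omega> w\<close> is the value of a trace on the product of the letters of \<open>w\<close>. Since letters of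
  the same block commute and are idempotent, its value on a left word followed by a right word
  depends only on the sets of letters involved.\<close>

locale tracial_words =
  fixes N :: nat and K1 K2 :: "nat set" and \<omega> :: "letter list \<Rightarrow> complex"
  assumes blocks: "K1 \<inter> K2 = {}" "K1 \<union> K2 = {..<N}"
    and unit: "\<omega> [] = 1"
    and trace: "\<lbrakk>x \<in> lists (K1 \<times> K1 \<union> K2 \<times> K2); y \<in> lists (K1 \<times> K1 \<union> K2 \<times> K2)\<rbrakk> \<Longrightarrow> \<omega> (x @ y) = \<omega> (y @ x)"
    and pos: "x \<in> lists (K1 \<times> K1 \<union> K2 \<times> K2) \<Longrightarrow> \<omega> (rev x @ x) \<in> \<real>\<^sub>\<ge>\<^sub>0"
    and commute: "\<lbrakk>K \<in> {K1, K2}; a \<in> K \<times> K; b \<in> K \<times> K;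
        x \<in> lists (K1 \<times> K1 \<union> K2 \<times> K2); y \<in> lists (K1 \<times> K1 \<union> K2 \<times> K2)\<rbrakk>
      \<Longrightarrow> \<omega> (x @ a # b # y) = \<omega> (x @ b # a # y)"
    and idem: "\<lbrakk>K \<in> {K1, K2}; a \<in> K \<times> K;
        x \<in> lists (K1 \<times> K1 \<union> K2 \<times> K2); y \<in> lists (K1 \<times> K1 \<union> K2 \<times> K2)\<rbrakk>
      \<Longrightarrow> \<omega> (x @ a # a # y) = \<omega> (x @ a # y)"
    and row_sum: "\<lbrakk>K \<in> {K1, K2}; i \<in> K;
        x \<in> lists (K1 \<times> K1 \<union> K2 \<times> K2); y \<in> lists (K1 \<times> K1 \<union> K2 \<times> K2)\<rbrakk>
      \<Longrightarrow> (\<Sum>k\<in>K. \<omega> (x @ (i, k) # y)) = \<omega> (x @ y)"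
    and col_sum: "\<lbrakk>K \<in> {K1, K2}; i \<in> K;
        x \<in> lists (K1 \<times> K1 \<union> K2 \<times> K2); y \<in> lists (K1 \<times> K1 \<union> K2 \<times> K2)\<rbrakk>
      \<Longrightarrow> (\<Sum>k\<in>K. \<omega> (x @ (k, i) # y)) = \<omega> (x @ y)"
begin

abbreviation "L \<equiv> K1 \<times> K1 \<union> K2 \<times> K2"

lemma block_lists: "K \<in> {K1, K2} \<Longrightarrow> w \<in> lists (K \<times> K) \<Longrightarrow> w \<in> lists L"
  by auto

lemma move_letter:
  assumes K: "K \<in> {K1, K2}" and a: "a \<in> K \<times> K" and w: "w \<in> lists (K \<times> K)"
    and "x \<in> lists L" and y: "y \<in> lists L"
  shows "\<omega> (x @ a # w @ y) = \<omega> (x @ w @ a # y)"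
  using w assms(4)
proof (induction w arbitrary: x)
  case (Cons b w)
  have "\<omega> (x @ a # (b # w) @ y) = \<omega> ((x @ [b]) @ a # w @ y)"
    using Cons y commute[OF K a, of b x "w @ y"] block_lists[OF K, of w] by simp
  also have "\<dots> = \<omega> ((x @ [b]) @ w @ a # y)"
    using Cons K by (intro Cons.IH) auto
  finally show ?case by simp
qed simp

text \<open>The extra copy of \<open>a\<close> travels through the single-block word until it meets
  the copy inside, where idempotence merges the two.\<close>

lemma absorb_letter:
  assumes K: "K \<in> {K1, K2}" and w: "w \<in> lists (K \<times> K)" and a: "a \<in> set w"
    and x: "x \<in> lists L" and y: "y \<in> lists L"
  shows "\<omega> (x @ a # w @ y) = \<omega> (x @ w @ y)"
proof -
  obtain w1 w2 where e: "w = w1 @ a # w2" using a by (auto dest: split_list)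
  then have mem: "a \<in> K \<times> K" "w1 \<in> lists (K \<times> K)" "w2 \<in> lists (K \<times> K)" using w by auto
  then have L: "a \<in> L" "w1 \<in> lists L" "w2 \<in> lists L" using K by auto
  have "\<omega> (x @ a # w1 @ (a # w2 @ y)) = \<omega> (x @ w1 @ a # a # w2 @ y)"
    using mem L y by (intro move_letter[OF K _ _ x]) auto
  also have "\<dots> = \<omega> ((x @ w1) @ a # w2 @ y)"
    using idem[OF K mem(1), of "x @ w1" "w2 @ y"] L x y by simp
  finally show ?thesis by (simp add: e)
qed

lemma absorb_word:
  assumes K: "K \<in> {K1, K2}" and w: "w \<in> lists (K \<times> K)" and "set w' \<subseteq> set w"
    and x: "x \<in> lists L" and y: "y \<in> lists L"
  shows "\<omega> (x @ w' @ w @ y) = \<omega> (x @ w @ y)"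
  using assms(3) x
proof (induction w' arbitrary: x)
  case (Cons a w')
  have a: "a \<in> L" using Cons.prems w K by auto
  have "\<omega> (x @ (a # w') @ w @ y) = \<omega> ((x @ [a]) @ w @ y)"
    using Cons.IH[of "x @ [a]"] Cons.prems a by simp
  also have "\<dots> = \<omega> (x @ w @ y)"
    using absorb_letter[OF K w, of a x y] Cons.prems y by simp
  finally show ?case .
qed simp

lemma swap_words:
  assumes K: "K \<in> {K1, K2}" and w: "w \<in> lists (K \<times> K)" and "w' \<in> lists (K \<times> K)"
    and x: "x \<in> lists L" and y: "y \<in> lists L"
  shows "\<omega> (x @ w' @ w @ y) = \<omega> (x @ w @ w' @ y)"
  using assms(3) x
proof (induction w' arbitrary: x rule: list.induct)
  case (Cons a w')
  have "a \<in> L" using Cons.prems K by auto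
  then have "\<omega> (x @ (a # w') @ w @ y) = \<omega> (x @ a # w @ (w' @ y))"
    using Cons.IH[of "x @ [a]"] Cons.prems by simp
  also have "\<dots> = \<omega> (x @ w @ a # (w' @ y))"
    using Cons.prems w y block_lists[OF K, of w'] by (intro move_letter[OF K]) auto
  finally show ?case by simp
qed simp

text \<open>Two words with the same letters absorb each other: put \<open>w\<close> in front of
  \<open>w'\<close>, exchange the two, and let \<open>w\<close> swallow \<open>w'\<close>. The
  context \<open>x\<close>, \<open>y\<close> may contain letters of both blocks.\<close>

lemma word_set_cong:
  assumes K: "K \<in> {K1, K2}" and w: "w \<in> lists (K \<times> K)" and e: "set w' = set w"
    and x: "x \<in> lists L" and y: "y \<in> lists L"
  shows "\<omega> (x @ w' @ y) = \<omega> (x @ w @ y)"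
proof -
  have w': "w' \<in> lists (K \<times> K)" using w e by (simp add: in_lists_conv_set)
  have "\<omega> (x @ w' @ y) = \<omega> (x @ w @ w' @ y)"
    using absorb_word[OF K w' _ x y, of w] e by simp
  also have "\<dots> = \<omega> (x @ w' @ w @ y)" using swap_words[OF K w w' x y] by simp
  also have "\<dots> = \<omega> (x @ w @ y)" using absorb_word[OF K w _ x y, of w'] e by simp
  finally show ?thesis .
qed

lemma nonneg:
  assumes u: "u \<in> lists (K1 \<times> K1)" and v: "v \<in> lists (K2 \<times> K2)"
  shows "\<omega> (u @ v) \<in> \<real>\<^sub>\<ge>\<^sub>0"
proof -
  have L: "u \<in> lists L" "v \<in> lists L" "rev u \<in> lists L" "rev v \<in> lists L"
    using u v by (auto simp: in_lists_conv_set)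
  have "\<omega> (u @ v) = \<omega> (rev u @ u @ v)"
    using word_set_cong[of K1 u "rev u @ u" "[]" v] u L by simp
  also have "\<dots> = \<omega> (rev u @ u @ v @ rev v)"
    using word_set_cong[of K2 v "v @ rev v" "rev u @ u" "[]"] v L by simp
  \<comment> \<open>Reversal is the involution on words. Since \<open>u\<close> and \<open>v\<close>
    were doubled on their outer sides, one cyclic shift yields \<open>rev z @ z\<close> with
    \<open>z = rev (u @ v)\<close>.\<close>
  also have "\<dots> = \<omega> ((u @ v @ rev v) @ rev u)"
    using L by (intro trace) simp_all
  also have "\<dots> = \<omega> (rev (rev (u @ v)) @ rev (u @ v))" by simp
  also have "\<dots> \<in> \<real>\<^sub>\<ge>\<^sub>0" using L by (intro pos) simp
  finally show ?thesis .
qed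

definition some_word :: "letter set \<Rightarrow> letter list" where
  "some_word S = (SOME w. set w = S)"

text \<open>Left letters are placed before right ones, the normal form for which positivity is
  available. The value zero off \<open>L\<close> reflects that the mixed entries of U \<oplus> V
  vanish.\<close>

definition moment :: "letter set \<Rightarrow> real" where
  "moment S = (if S \<subseteq> L
    then Re (\<omega> (some_word (S \<inter> K1 \<times> K1) @ some_word (S \<inter> K2 \<times> K2))) else 0)"

lemma set_some_word: "finite S \<Longrightarrow> set (some_word S) = S"
  unfolding some_word_def by (rule someI_ex) (rule finite_list)

lemma moment_eq:
  assumes u: "u \<in> lists (K1 \<times> K1)" and v: "v \<in> lists (K2 \<times> K2)"
  shows "of_real (moment (set u \<union> set v)) = \<omega> (u @ v)"
proof -
  let ?S = "set u \<union> set v"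
  have set: "set u \<subseteq> K1 \<times> K1" "set v \<subseteq> K2 \<times> K2" using u v by auto
  then have S: "?S \<inter> K1 \<times> K1 = set u" "?S \<inter> K2 \<times> K2 = set v" "?S \<subseteq> L"
    using blocks(1) by auto
  let ?u = "some_word (set u)" and ?v = "some_word (set v)"
  have e: "set ?u = set u" "set ?v = set v" by (simp_all add: set_some_word)
  then have uv: "?u \<in> lists (K1 \<times> K1)" "?v \<in> lists (K2 \<times> K2)"
    using set by (auto simp: in_lists_conv_set)
  have "\<omega> (?u @ ?v) = \<omega> (u @ ?v)"
    using word_set_cong[of K1 u ?u "[]" ?v] u uv e block_lists[of K2 ?v] by simp
  also have "\<dots> = \<omega> (u @ v)"
    using word_set_cong[of K2 v ?v u "[]"] v e block_lists[of K1 u] u by simp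
  finally have "moment ?S = Re (\<omega> (u @ v))"
    by (simp only: moment_def S if_True)
  then show ?thesis
    using nonneg[OF u v] by (auto simp: nonneg_Reals_def)
qed

lemma finite_L: "finite L"
proof -
  have "finite (K1 \<union> K2)" by (simp add: blocks)
  then show ?thesis by simp
qed

lemma words_for:
  assumes "S \<subseteq> L"
  obtains u v where "u \<in> lists (K1 \<times> K1)" "v \<in> lists (K2 \<times> K2)" "S = set u \<union> set v"
proof -
  have "finite S" using assms finite_L by (rule finite_subset)
  then have "set (some_word (S \<inter> K1 \<times> K1)) = S \<inter> K1 \<times> K1"
    "set (some_word (S \<inter> K2 \<times> K2)) = S \<inter> K2 \<times> K2"
    by (simp_all add: set_some_word)
  then show ?thesis using assms
    by (intro that[of "some_word (S \<inter> K1 \<times> K1)" "some_word (S \<inter> K2 \<times> K2)"])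
      (auto simp: in_lists_conv_set)
qed

text \<open>The function \<open>h\<close> stands for a row or a column of letters, so both sums are
  treated at once. Indices outside \<open>K\<close> give letters outside \<open>L\<close> and
  contribute zero. The new letter enters at the front of the word for \<open>K1\<close> and between
  the two parts for \<open>K2\<close>, which keeps the normal form.\<close>

lemma moment_sum:
  assumes K: "K \<in> {K1, K2}" and h: "\<And>k. k \<in> K \<Longrightarrow> h k \<in> K \<times> K"
    and out: "\<And>k. k \<notin> K \<Longrightarrow> h k \<notin> L"
    and sum: "\<And>x y. x \<in> lists L \<Longrightarrow> y \<in> lists L \<Longrightarrow> (\<Sum>k\<in>K. \<omega> (x @ h k # y)) = \<omega> (x @ y)"
  shows "(\<Sum>k<N. moment (insert (h k) S)) = moment S"
proof (cases "S \<subseteq> L")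
  case False
  then show ?thesis by (simp add: moment_def)
next
  case True
  then obtain u v where u: "u \<in> lists (K1 \<times> K1)" and v: "v \<in> lists (K2 \<times> K2)"
    and S: "S = set u \<union> set v" by (rule words_for)
  have L: "u \<in> lists L" "v \<in> lists L" using u v by auto
  have K_sub: "K \<subseteq> {..<N}" using K blocks(2) by auto
  obtain x y where xy: "x @ y = u @ v" "x \<in> lists L" "y \<in> lists L"
    "\<And>k. k \<in> K \<Longrightarrow> of_real (moment (insert (h k) S)) = \<omega> (x @ h k # y)"
  proof (cases "K = K1")
    case True
    have "of_real (moment (insert (h k) S)) = \<omega> ([] @ h k # u @ v)" if "k \<in> K" for k
      using moment_eq[of "h k # u" v] h[OF that] u v True by (simp add: S)
    then show ?thesis using L by (intro that[of "[]" "u @ v"]) auto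
  next
    case False
    then have "K = K2" using K by simp
    then have "of_real (moment (insert (h k) S)) = \<omega> (u @ h k # v)" if "k \<in> K" for k
      using moment_eq[of u "h k # v"] h[OF that] u v by (simp add: S)
    then show ?thesis using L by (intro that[of u v]) auto
  qed
  have "(\<Sum>k<N. moment (insert (h k) S)) = (\<Sum>k\<in>K. moment (insert (h k) S))"
    using K_sub out by (intro sum.mono_neutral_right) (auto simp: moment_def)
  then have "of_real (\<Sum>k<N. moment (insert (h k) S)) = (\<Sum>k\<in>K. \<omega> (x @ h k # y))"
    by (simp add: xy(4))
  also have "\<dots> = of_real (moment S)"
    using moment_eq[OF u v] xy by (simp add: sum S)
  finally show ?thesis by (simp only: of_real_eq_iff)
qed

theorem local_correlation_words:
  "local_correlation N
     (\<lambda>l k i j. if (i, l) \<in> L \<and> (j, k) \<in> L then \<omega> [(i, l), (j, k)] else 0)"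
proof (rule local_correlation_of_moments[where \<mu> = moment])
  show "0 \<le> moment S" for S
  proof (cases "S \<subseteq> L")
    case True
    then obtain u v where uv: "u \<in> lists (K1 \<times> K1)" "v \<in> lists (K2 \<times> K2)" "S = set u \<union> set v"
      by (rule words_for)
    have "complex_of_real (moment S) \<in> \<real>\<^sub>\<ge>\<^sub>0"
      using nonneg[OF uv(1,2)] by (simp only: uv(3) moment_eq[OF uv(1,2)])
    then show ?thesis by simp
  qed (simp add: moment_def)
  show "moment {} = 1"
    using moment_eq[of "[]" "[]"] unit by simp
next
  fix S i assume "i < N"
  then obtain K where K: "K \<in> {K1, K2}" "i \<in> K" using blocks(2) by auto
  have out: "(i, k) \<notin> L" "(k, i) \<notin> L" if "k \<notin> K" for k
    using K that blocks(1) by auto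
  show "(\<Sum>k<N. moment (insert (i, k) S)) = moment S"
    using K out by (intro moment_sum[of K] row_sum) auto
  show "(\<Sum>k<N. moment (insert (k, i) S)) = moment S"
    using K out by (intro moment_sum[of K "\<lambda>k. (k, i)"] col_sum) auto
next
  fix l k i j
  have "(if a \<in> L \<and> b \<in> L then \<omega> [a, b] else 0) = of_real (moment {a, b})" for a b
  proof (cases "a \<in> L \<and> b \<in> L")
    case True
    then consider "a \<in> K1 \<times> K1" "b \<in> K1 \<times> K1" | "a \<in> K1 \<times> K1" "b \<in> K2 \<times> K2"
      | "a \<in> K2 \<times> K2" "b \<in> K1 \<times> K1" | "a \<in> K2 \<times> K2" "b \<in> K2 \<times> K2" by auto
    then have "of_real (moment {a, b}) = \<omega> [a, b]"
    proof cases
      case 1 then show ?thesis using moment_eq[of "[a, b]" "[]"] by simp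
    next
      case 2 then show ?thesis using moment_eq[of "[a]" "[b]"] by (simp add: insert_commute[of b a])
    next
      \<comment> \<open>The right letter comes first here; the trace property restores the order
        left before right.\<close>
      case 3 then show ?thesis
        using moment_eq[of "[b]" "[a]"] trace[of "[a]" "[b]"] by simp
    next
      case 4 then show ?thesis using moment_eq[of "[]" "[a, b]"] by simp
    qed
    then show ?thesis using True by simp
  qed (auto simp: moment_def)
  then show "(if (i, l) \<in> L \<and> (j, k) \<in> L then \<omega> [(i, l), (j, k)] else 0)
      = of_real (moment {(i, l), (j, k)})" .
qed

end

section \<open>The universal norm and the relations of the free product\<close>

context involutive_monoid
begin

lemma F_induct [consumes 1, case_names zero add]:
  assumes "f \<in> carrier F" and zero: "P \<zero>\<^bsub>F\<^esub>"
    and add: "\<And>f c x. \<lbrakk>f \<in> carrier F; x \<in> carrier M; P f\<rbrakk> \<Longrightarrow> P (f \<oplus>\<^bsub>F\<^esub> c \<odot>\<^bsub>F\<^esub> point_fun x)"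
  shows "P f"
proof -
  have "P f" if "finite S" "support f \<subseteq> S" "S \<subseteq> carrier M" for S f
    using that
  proof (induction S arbitrary: f rule: finite_induct)
    case empty
    then have "f = \<zero>\<^bsub>F\<^esub>" by (auto simp: support_def zero_F)
    then show ?case by (simp add: zero)
  next
    case (insert x S)
    have "support (f(x := 0)) \<subseteq> S" using insert.prems by (auto simp: support_def)
    moreover from this have "f(x := 0) \<in> carrier F"
      using insert by (auto simp: mem_F intro: finite_subset)
    ultimately have "P (f(x := 0) \<oplus>\<^bsub>F\<^esub> f x \<odot>\<^bsub>F\<^esub> point_fun x)"
      using insert by (intro add) auto
    moreover have "f(x := 0) \<oplus>\<^bsub>F\<^esub> f x \<odot>\<^bsub>F\<^esub> point_fun x = f"
      by (auto simp: add_F smult_F point_fun_def)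
    ultimately show ?case by simp
  qed
  then show ?thesis using assms(1) by (auto simp: mem_F)
qed

lemma linear_eq_lin:
  assumes add: "\<And>f g. \<lbrakk>f \<in> carrier F; g \<in> carrier F\<rbrakk> \<Longrightarrow> \<sigma> (f \<oplus>\<^bsub>F\<^esub> g) = \<sigma> f + \<sigma> g"
    and smult: "\<And>c f. f \<in> carrier F \<Longrightarrow> \<sigma> (c \<odot>\<^bsub>F\<^esub> f) = c * \<sigma> f"
    and f: "f \<in> carrier F"
  shows "\<sigma> f = lin (\<lambda>x. \<sigma> (point_fun x)) f"
  using f
proof (induction f rule: F_induct)
  case zero
  have "\<zero>\<^bsub>F\<^esub> \<in> carrier F" "0 \<odot>\<^bsub>F\<^esub> \<zero>\<^bsub>F\<^esub> = \<zero>\<^bsub>F\<^esub>"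
    by (simp_all add: mem_F zero_F smult_F support_zero)
  then show ?case using smult[of "\<zero>\<^bsub>F\<^esub>" 0] by (simp add: lin_zero)
next
  case (add f c x)
  then show ?case by (simp add: assms(1,2) F_closed lin_F)
qed

text \<open>Homogeneity and the triangle inequality carry bounds from basis elements to finite
  combinations, so finiteness of the universal norm has to be checked on words only.\<close>

lemma bdd_above_seminorms:
  assumes Q: "\<And>q. q \<in> Q \<Longrightarrow> cstar_seminorm F q"
    and bdd: "\<And>x. x \<in> carrier M \<Longrightarrow> bdd_above ((\<lambda>q. q (point_fun x)) ` Q)"
    and f: "f \<in> carrier F"
  shows "bdd_above ((\<lambda>q. q f) ` Q)"
proof -
  have Q': "cstar_seminormed F q" if "q \<in> Q" for q
    by (intro cstar_seminormed.intro cstar_seminormed_axioms.intro star_algebra_F Q that)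
  show ?thesis
    using f
  proof (induction f rule: F_induct)
    case zero
    show ?case
      by (rule bdd_aboveI2[of _ _ 0]) (simp only: cstar_seminormed.q_zero[OF Q'] order_refl)
  next
    case (add f c x)
    obtain B1 B2 where B: "\<And>q. q \<in> Q \<Longrightarrow> q f \<le> B1" "\<And>q. q \<in> Q \<Longrightarrow> q (point_fun x) \<le> B2"
      using add(3) bdd[OF add(2)] by (auto simp: bdd_above_def)
    have "q (f \<oplus>\<^bsub>F\<^esub> c \<odot>\<^bsub>F\<^esub> point_fun x) \<le> B1 + cmod c * B2" if q: "q \<in> Q" for q
    proof -
      have "q (f \<oplus>\<^bsub>F\<^esub> c \<odot>\<^bsub>F\<^esub> point_fun x) \<le> q f + q (c \<odot>\<^bsub>F\<^esub> point_fun x)"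
        using add by (intro cstar_seminormed.q_add[OF Q'[OF q]] F_closed)
      also have "q (c \<odot>\<^bsub>F\<^esub> point_fun x) = cmod c * q (point_fun x)"
        using add by (intro cstar_seminormed.q_smult[OF Q'[OF q]] F_closed)
      also have "q f + cmod c * q (point_fun x) \<le> B1 + cmod c * B2"
        using B[OF q] by (intro add_mono mult_left_mono) auto
      finally show ?thesis .
    qed
    then show ?case by (rule bdd_aboveI2)
  qed
qed

end

text \<open>Nonemptiness and pointwise boundedness make the real supremum a genuine least upper
  bound; the axioms then pass to it because scaling and squaring are monotone on nonnegative
  reals.\<close>

lemma (in star_algebra) cstar_seminorm_SUP:
  assumes ne: "Q \<noteq> {}" and Q: "\<And>q. q \<in> Q \<Longrightarrow> cstar_seminorm A q"
    and bdd: "\<And>x. x \<in> carrier A \<Longrightarrow> bdd_above ((\<lambda>q. q x) ` Q)"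
  shows "cstar_seminorm A (\<lambda>x. SUP q\<in>Q. q x)"
proof -
  let ?p = "\<lambda>x. SUP q\<in>Q. q x"
  have up: "q x \<le> ?p x" if "q \<in> Q" "x \<in> carrier A" for q x
    using that bdd by (intro cSUP_upper)
  have least: "?p x \<le> b" if "\<And>q. q \<in> Q \<Longrightarrow> q x \<le> b" for x b
    using that ne by (intro cSUP_least)
  have nonneg: "0 \<le> q x" if "q \<in> Q" "x \<in> carrier A" for q x
    using that Q by (simp add: cstar_seminorm_def)
  have p_nonneg: "0 \<le> ?p x" if x: "x \<in> carrier A" for x
  proof -
    from ne obtain q where "q \<in> Q" by blast
    then show ?thesis using nonneg[of q x] up[of q x] x by simp
  qed
  have smult: "?p (c \<odot> x) = cmod c * ?p x" if x: "x \<in> carrier A" for c x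
  proof (rule antisym)
    have q: "q (c \<odot> x) = cmod c * q x" if "q \<in> Q" for q
      using Q[OF that] x by (simp add: cstar_seminorm_def)
    show "?p (c \<odot> x) \<le> cmod c * ?p x"
      using x up by (intro least) (auto simp: q intro!: mult_left_mono)
    show "cmod c * ?p x \<le> ?p (c \<odot> x)"
    proof (cases "c = 0")
      case False
      have "?p x \<le> ?p (c \<odot> x) / cmod c"
      proof (rule least)
        fix r assume r: "r \<in> Q"
        have "cmod c * r x \<le> ?p (c \<odot> x)"
          using up[OF r smult_closed[OF x, of c]] q[OF r] by simp
        then show "r x \<le> ?p (c \<odot> x) / cmod c"
          using False by (simp add: pos_le_divide_eq mult.commute)
      qed
      then show ?thesis using False by (simp add: pos_le_divide_eq mult.commute)
    qed (use p_nonneg x smult_closed in simp)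
  qed
  have cstar: "?p (star A x \<otimes> x) = (?p x)\<^sup>2" if x: "x \<in> carrier A" for x
  proof (rule antisym)
    have q: "q (star A x \<otimes> x) = (q x)\<^sup>2" if "q \<in> Q" for q
      using Q[OF that] x by (simp add: cstar_seminorm_def)
    have c: "star A x \<otimes> x \<in> carrier A" using x by (simp add: star_closed)
    show "?p (star A x \<otimes> x) \<le> (?p x)\<^sup>2"
      using x up nonneg by (intro least) (auto simp: q intro!: power_mono)
    \<comment> \<open>Square roots turn the C*-identity of each member into an upper bound for
      \<open>r x\<close> that is uniform in \<open>r\<close>; it is squared after the supremum has
      been taken.\<close>
    have "?p x \<le> sqrt (?p (star A x \<otimes> x))"
    proof (rule least)
      fix r assume r: "r \<in> Q"
      show "r x \<le> sqrt (?p (star A x \<otimes> x))"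
        using up[OF r c] q[OF r] by (intro real_le_rsqrt) simp
    qed
    then have "(?p x)\<^sup>2 \<le> (sqrt (?p (star A x \<otimes> x)))\<^sup>2"
      using p_nonneg[OF x] by (rule power_mono)
    then show "(?p x)\<^sup>2 \<le> ?p (star A x \<otimes> x)"
      using p_nonneg[OF c] by simp
  qed
  have add: "?p (x \<oplus> y) \<le> ?p x + ?p y" if "x \<in> carrier A" "y \<in> carrier A" for x y
  proof (rule least)
    fix r assume r: "r \<in> Q"
    have "r (x \<oplus> y) \<le> r x + r y" using Q[OF r] that by (simp add: cstar_seminorm_def)
    then show "r (x \<oplus> y) \<le> ?p x + ?p y" using up[OF r that(1)] up[OF r that(2)] by simp
  qed
  have mult: "?p (x \<otimes> y) \<le> ?p x * ?p y" if "x \<in> carrier A" "y \<in> carrier A" for x y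
  proof (rule least)
    fix r assume r: "r \<in> Q"
    have "r (x \<otimes> y) \<le> r x * r y" using Q[OF r] that by (simp add: cstar_seminorm_def)
    also have "\<dots> \<le> ?p x * ?p y"
      using r that by (intro mult_mono up nonneg p_nonneg)
    finally show "r (x \<otimes> y) \<le> ?p x * ?p y" .
  qed
  show ?thesis
    unfolding cstar_seminorm_def using p_nonneg smult cstar add mult by simp
qed

section \<open>Relations as polynomials in the letters, and their evaluation\<close>

lemma involutive_monoid_words:
  "involutive_monoid \<lparr>carrier = lists X, monoid.mult = (@), one = []\<rparr> rev"
  by unfold_locales (auto simp: in_lists_conv_set)

text \<open>A relation between words becomes a single polynomial that should vanish. For
  \<open>t\<close> outside \<open>S\<close>, its coefficients are 1 on \<open>S\<close> and -1 at
  \<open>t\<close>.\<close>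

definition relator :: "'l list set \<Rightarrow> 'l list \<Rightarrow> 'l list \<Rightarrow> complex" where
  "relator S t = (\<lambda>z. (if z \<in> S then 1 else 0) - (if z = t then 1 else 0))"

lemma support_relator: "t \<notin> S \<Longrightarrow> support (relator S t) = insert t S"
  by (auto simp: support_def relator_def)

lemma lin_relator:
  assumes "finite S" "t \<notin> S"
  shows "lin \<phi> (relator S t) = (\<Sum>w\<in>S. \<phi> w) - \<phi> t"
proof -
  have "(\<Sum>w\<in>S. relator S t w * \<phi> w) = (\<Sum>w\<in>S. \<phi> w)"
    using assms by (intro sum.cong) (auto simp: relator_def)
  then show ?thesis
    using assms by (simp add: lin_def support_relator) (simp add: relator_def)
qed

lemma relator_closed:
  "\<lbrakk>finite S; S \<subseteq> lists X; t \<in> lists X; t \<notin> S\<rbrakk> \<Longrightarrow> relator S t \<in> carrier (free_star_algebra X)"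
  by (simp add: free_star_algebra_def involutive_monoid.mem_F[OF involutive_monoid_words]
      support_relator)

text \<open>\<open>magic_relation K S t\<close> encodes the relation that the words in \<open>S\<close> sum up to the word \<open>t\<close>.\<close>

inductive magic_relation :: "nat set \<Rightarrow> letter list set \<Rightarrow> letter list \<Rightarrow> bool" for K where
  commute: "\<lbrakk>a \<in> K \<times> K; b \<in> K \<times> K; a \<noteq> b\<rbrakk> \<Longrightarrow> magic_relation K {[a, b]} [b, a]"
| idem: "a \<in> K \<times> K \<Longrightarrow> magic_relation K {[a, a]} [a]"
| row: "i \<in> K \<Longrightarrow> magic_relation K ((\<lambda>k. [(i, k)]) ` K) []"
| col: "i \<in> K \<Longrightarrow> magic_relation K ((\<lambda>k. [(k, i)]) ` K) []"

text \<open>The right-hand word never occurs on the left: in the commutation case because the two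
  letters differ, in all others because the lengths differ.\<close>

lemma magic_relation_words:
  assumes "magic_relation K S t"
  shows "finite K \<Longrightarrow> finite S" and "S \<subseteq> lists (K \<times> K)" and "t \<in> lists (K \<times> K)" and "t \<notin> S"
  using assms by (cases; auto)+

context star_algebra
begin

abbreviation word_prod :: "('l \<Rightarrow> 'a) \<Rightarrow> 'l list \<Rightarrow> 'a" where
  "word_prod v w \<equiv> foldr (\<lambda>l x. v l \<otimes> x) w \<one>"

lemma word_prod_closed: "v \<in> X \<rightarrow> carrier A \<Longrightarrow> w \<in> lists X \<Longrightarrow> word_prod v w \<in> carrier A"
  by (induction w) auto

lemma poly_eval_closed:
  assumes "v \<in> X \<rightarrow> carrier A" "P \<in> carrier (free_star_algebra X)"
  shows "poly_eval A v P \<in> carrier A"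
proof -
  have "support P \<subseteq> lists X"
    using assms(2)
    by (simp add: free_star_algebra_def involutive_monoid.mem_F[OF involutive_monoid_words])
  then show ?thesis
    unfolding poly_eval_def using assms(1)
    by (auto intro!: finsum_closed smult_closed word_prod_closed[OF assms(1)])
qed

lemma poly_eval_relator:
  assumes v: "v \<in> X \<rightarrow> carrier A" and S: "finite S" "S \<subseteq> lists X" and t: "t \<in> lists X" "t \<notin> S"
    and eq: "(\<Oplus>w\<in>S. word_prod v w) = word_prod v t"
  shows "poly_eval A v (relator S t) = \<zero>"
proof -
  have c: "word_prod v w \<in> carrier A" if "w \<in> insert t S" for w
    using that S t by (intro word_prod_closed[OF v]) auto
  have "(\<Oplus>w\<in>S. relator S t w \<odot> word_prod v w) = (\<Oplus>w\<in>S. word_prod v w)"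
    using c t by (intro finsum_cong') (auto simp: relator_def smult_one)
  moreover have "relator S t t \<odot> word_prod v t = \<ominus> word_prod v t"
    using c t by (simp add: relator_def smult_minus_one)
  ultimately show ?thesis
    unfolding poly_eval_def support_relator[OF t(2)] using S t c eq
    by (subst finsum_insert) (auto simp: smult_closed l_neg)
qed

text \<open>Commutativity of the algebra settles the relations a b = b a, which the entries of a
  magic unitary may violate in general. The other relations are the defining ones of a magic
  unitary, up to the trailing unit in \<open>word_prod\<close>.\<close>

lemma poly_eval_magic_relation:
  assumes S: "magic_relation K S t" and K: "finite K"
    and comm: "\<And>x y. \<lbrakk>x \<in> carrier A; y \<in> carrier A\<rbrakk> \<Longrightarrow> x \<otimes> y = y \<otimes> x"
    and v: "v \<in> K \<times> K \<rightarrow> carrier A"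
    and idem: "\<And>a. a \<in> K \<times> K \<Longrightarrow> v a \<otimes> v a = v a"
    and row: "\<And>i. i \<in> K \<Longrightarrow> (\<Oplus>k\<in>K. v (i, k)) = \<one>"
    and col: "\<And>i. i \<in> K \<Longrightarrow> (\<Oplus>k\<in>K. v (k, i)) = \<one>"
  shows "poly_eval A v (relator S t) = \<zero>"
proof (rule poly_eval_relator[OF v magic_relation_words(1)[OF S K] magic_relation_words(2-4)[OF S]])
  have c: "v a \<in> carrier A" if "a \<in> K \<times> K" for a using v that by blast
  show "(\<Oplus>w\<in>S. word_prod v w) = word_prod v t"
    using S
  proof cases
    case (commute a b)
    then show ?thesis using c comm[of "v a" "v b"] by (simp add: finsum_insert)
  next
    case (idem a)
    then show ?thesis using c assms(5)[of a] by (simp add: finsum_insert)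
  next
    case (row i)
    have "(\<Oplus>w\<in>(\<lambda>k. [(i, k)]) ` K. word_prod v w) = (\<Oplus>k\<in>K. v (i, k) \<otimes> \<one>)"
      using row c by (subst finsum_reindex) (auto simp: inj_on_def)
    also have "\<dots> = (\<Oplus>k\<in>K. v (i, k))"
      using row c by (intro finsum_cong') auto
    finally show ?thesis using row assms(6) by simp
  next
    case (col i)
    have "(\<Oplus>w\<in>(\<lambda>k. [(k, i)]) ` K. word_prod v w) = (\<Oplus>k\<in>K. v (k, i) \<otimes> \<one>)"
      using col c by (subst finsum_reindex) (auto simp: inj_on_def)
    also have "\<dots> = (\<Oplus>k\<in>K. v (k, i))"
      using col c by (intro finsum_cong') auto
    finally show ?thesis using col assms(7) by simp
  qed
qed

end

section \<open>The universal norm of the free product and its null elements\<close>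

locale commutative_free_product =
  fixes G :: "'a matrix_qgroup" and H :: "'b matrix_qgroup"
  assumes qpg_G: "quantum_permutation_group G" and qpg_H: "quantum_permutation_group H"
    and cring_G: "cring (fun_alg G)" and cring_H: "cring (fun_alg H)"
begin

abbreviation "A \<equiv> fun_alg G"
abbreviation "B \<equiv> fun_alg H"
abbreviation "K1 \<equiv> {..<fund_dim G}"
abbreviation "K2 \<equiv> {fund_dim G..<fund_dim G + fund_dim H}"
abbreviation "L \<equiv> K1 \<times> K1 \<union> K2 \<times> K2"
abbreviation "u \<equiv> \<lambda>(i, j). fund_rep G i j"
abbreviation "v \<equiv> \<lambda>(i, j). fund_rep H (i - fund_dim G) (j - fund_dim G)"
abbreviation "FP \<equiv> free_product_algebra G H"
abbreviation "p \<equiv> free_product_norm G H"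

lemma FP_eq: "FP = monoid_star_algebra \<lparr>carrier = lists L, monoid.mult = (@), one = []\<rparr> rev"
  by (simp add: free_product_algebra_def free_star_algebra_def left_letters_def right_letters_def)

text \<open>The rewrites remove the anonymous monoid record, so that the inherited facts speak about
  \<open>FP\<close>, \<open>lists L\<close> and concatenation.\<close>

sublocale words: involutive_monoid "\<lparr>carrier = lists L, monoid.mult = (@), one = []\<rparr>" rev
  rewrites "monoid_star_algebra \<lparr>carrier = lists L, monoid.mult = (@), one = []\<rparr> rev = FP"
    and "carrier \<lparr>carrier = lists L, monoid.mult = (@), one = []\<rparr> = lists L"
    and "monoid.mult \<lparr>carrier = lists L, monoid.mult = (@), one = []\<rparr> = (@)"
    and "one \<lparr>carrier = lists L, monoid.mult = (@), one = []\<rparr> = []"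
  by (simp_all add: involutive_monoid_words FP_eq)

lemma cstar_A: "cstar_algebra A" and cstar_B: "cstar_algebra B"
  and magic_A: "magic_unitary A (fund_dim G) (fund_rep G)"
  and magic_B: "magic_unitary B (fund_dim H) (fund_rep H)"
  using qpg_G qpg_H
  by (auto simp: quantum_permutation_group_def compact_matrix_quantum_group_def Let_def)

interpretation A: cstar_algebra A by (rule cstar_A)
interpretation B: cstar_algebra B by (rule cstar_B)
interpretation An: cstar_seminormed A "nrm A"
  by unfold_locales (rule A.nrm_cstar_seminorm)
interpretation Bn: cstar_seminormed B "nrm B"
  by unfold_locales (rule B.nrm_cstar_seminorm)

lemma u_closed: "u \<in> K1 \<times> K1 \<rightarrow> carrier A"
  using magic_A by (auto simp: magic_unitary_def)

lemma v_closed: "v \<in> K2 \<times> K2 \<rightarrow> carrier B"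
  using magic_B by (auto simp: magic_unitary_def)

definition seminorms :: "((letter list \<Rightarrow> complex) \<Rightarrow> real) set" where
  "seminorms = {q. cstar_seminorm FP q \<and>
     (\<forall>P \<in> carrier (free_star_algebra (K1 \<times> K1)). q P \<le> nrm A (poly_eval A u P)) \<and>
     (\<forall>P \<in> carrier (free_star_algebra (K2 \<times> K2)). q P \<le> nrm B (poly_eval B v P))}"

lemma p_eq: "p = (\<lambda>x. SUP q\<in>seminorms. q x)"
  unfolding free_product_norm_def seminorms_def left_letters_def right_letters_def Let_def
  by (simp add: image_Collect)

text \<open>Ensures that the supremum defining the universal norm runs over a nonempty
  family.\<close>

lemma zero_seminorm: "(\<lambda>_. 0) \<in> seminorms"
  using An.q_nonneg[OF A.poly_eval_closed[OF u_closed]] Bn.q_nonneg[OF B.poly_eval_closed[OF v_closed]]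
  by (simp add: seminorms_def cstar_seminorm_def)

lemma seminormsD: "q \<in> seminorms \<Longrightarrow> cstar_seminorm FP q"
  by (simp add: seminorms_def)

lemma point_in_free: "w \<in> lists X \<Longrightarrow> point_fun w \<in> carrier (free_star_algebra X)"
  by (simp add: free_star_algebra_def involutive_monoid.mem_F[OF involutive_monoid_words]
      support_point_fun)

text \<open>A letter belongs to one block, so the norm of its evaluation bounds all admissible
  seminorms at once; longer words follow by submultiplicativity. The empty word is bounded as a
  polynomial in the left letters.\<close>

lemma bdd_word: "w \<in> lists L \<Longrightarrow> bdd_above ((\<lambda>q. q (point_fun w)) ` seminorms)"
proof (induction w)
  case Nil
  show ?case
    by (rule bdd_aboveI2[of _ _ "nrm A (poly_eval A u (point_fun []))"])
      (simp add: seminorms_def point_in_free)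
next
  case (Cons a w)
  then have a: "a \<in> L" and w: "w \<in> lists L" by simp_all
  have "bdd_above ((\<lambda>q. q (point_fun [a])) ` seminorms)"
  proof (cases "a \<in> K1 \<times> K1")
    case True
    then show ?thesis
      by (intro bdd_aboveI2[of _ _ "nrm A (poly_eval A u (point_fun [a]))"])
        (simp add: seminorms_def point_in_free)
  next
    case False
    then have "a \<in> K2 \<times> K2" using a by simp
    then show ?thesis
      by (intro bdd_aboveI2[of _ _ "nrm B (poly_eval B v (point_fun [a]))"])
        (simp add: seminorms_def point_in_free)
  qed
  then obtain b1 where b1: "\<And>q. q \<in> seminorms \<Longrightarrow> q (point_fun [a]) \<le> b1"
    by (auto simp: bdd_above_def)
  obtain b2 where b2: "\<And>q. q \<in> seminorms \<Longrightarrow> q (point_fun w) \<le> b2"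
    using Cons.IH[OF w] by (auto simp: bdd_above_def)
  have c: "point_fun [a] \<in> carrier FP" "point_fun w \<in> carrier FP"
    using a w by (auto intro: words.point_closed)
  have e: "point_fun (a # w) = point_fun [a] \<otimes>\<^bsub>FP\<^esub> point_fun w"
    using words.mult_point_F[of "[a]" w] a w by simp
  show ?case
  proof (rule bdd_aboveI2)
    fix q assume q: "q \<in> seminorms"
    have "q (point_fun (a # w)) \<le> q (point_fun [a]) * q (point_fun w)"
      using seminormsD[OF q] c by (simp add: e cstar_seminorm_def)
    also have "\<dots> \<le> b1 * b2"
      using b1[OF q] b2[OF q] seminormsD[OF q] c
      by (intro mult_mono) (auto simp: cstar_seminorm_def intro: order_trans)
    finally show "q (point_fun (a # w)) \<le> b1 * b2" .
  qed
qed

sublocale FP: cstar_seminormed FP p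
proof (intro cstar_seminormed.intro cstar_seminormed_axioms.intro words.star_algebra_F)
  show "cstar_seminorm FP p"
    unfolding p_eq
  proof (rule star_algebra.cstar_seminorm_SUP[OF words.star_algebra_F _ seminormsD])
    show "seminorms \<noteq> {}" using zero_seminorm by blast
    show "bdd_above ((\<lambda>q. q f) ` seminorms)" if "f \<in> carrier FP" for f
      by (rule words.bdd_above_seminorms[OF _ _ that]) (simp_all only: seminormsD bdd_word)
  qed
qed

lemma p_null:
  assumes "x \<in> carrier FP" "\<And>q. q \<in> seminorms \<Longrightarrow> q x \<le> 0"
  shows "p x = 0"
proof -
  have "p x \<le> 0"
    unfolding p_eq using assms(2) zero_seminorm by (intro cSUP_least) auto
  then show ?thesis using FP.q_nonneg[OF assms(1)] by simp
qed

lemma relator_in_FP: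
  "\<lbrakk>finite S; S \<subseteq> lists L; t \<in> lists L; t \<notin> S\<rbrakk> \<Longrightarrow> relator S t \<in> carrier FP"
  by (simp add: words.mem_F support_relator)

text \<open>Undoes the shift by \<open>fund_dim G\<close> in the indices of the right letters, so
  that the row and column sums of the second magic unitary apply.\<close>

lemma v_sum:
  assumes f: "f \<in> {..<fund_dim H} \<rightarrow> carrier B"
  shows "(\<Oplus>\<^bsub>B\<^esub>k\<in>K2. f (k - fund_dim G)) = (\<Oplus>\<^bsub>B\<^esub>k\<in>{..<fund_dim H}. f k)"
proof -
  let ?h = "\<lambda>k. k + fund_dim G"
  have K2: "K2 = ?h ` {..<fund_dim H}"
    by (metis add.commute add.right_neutral image_add_atLeastLessThan' lessThan_atLeast0)
  have "(\<Oplus>\<^bsub>B\<^esub>k\<in>?h ` {..<fund_dim H}. f (k - fund_dim G)) = (\<Oplus>\<^bsub>B\<^esub>k\<in>{..<fund_dim H}. f (?h k - fund_dim G))"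
    using f by (intro B.finsum_reindex) auto
  then show ?thesis by (simp add: K2)
qed

text \<open>The relator evaluates to zero in the algebra of its block, whose norm dominates every
  admissible seminorm on polynomials in that block; hence all of them vanish, and so does their
  supremum.\<close>

lemma p_magic_relation:
  assumes K: "K \<in> {K1, K2}" and S: "magic_relation K S t"
  shows "p (relator S t) = 0"
proof (rule p_null)
  note words = magic_relation_words[OF S]
  have fin: "finite S" using K words(1) by auto
  have "lists (K \<times> K) \<subseteq> lists L" using K by (intro lists_mono) auto
  then show "relator S t \<in> carrier FP" using fin words(2-4) by (intro relator_in_FP) blast+
  fix q assume q: "q \<in> seminorms"
  note free = relator_closed[OF fin words(2-4)]
  consider "K = K1" | "K = K2" using K by blast
  then show "q (relator S t) \<le> 0"
  proof cases
    case 1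
    have "poly_eval A u (relator S t) = \<zero>\<^bsub>A\<^esub>"
    proof (rule A.poly_eval_magic_relation[OF S[unfolded 1] _ _ u_closed])
      show "u a \<otimes>\<^bsub>A\<^esub> u a = u a" if "a \<in> K1 \<times> K1" for a
        using magic_A that by (auto simp: magic_unitary_def)
      show "(\<Oplus>\<^bsub>A\<^esub>k\<in>K1. u (i, k)) = \<one>\<^bsub>A\<^esub>" "(\<Oplus>\<^bsub>A\<^esub>k\<in>K1. u (k, i)) = \<one>\<^bsub>A\<^esub>" if "i \<in> K1" for i
        using magic_A that by (auto simp: magic_unitary_def)
    qed (use comm_monoid.m_comm[OF cring.axioms(2)[OF cring_G]] in simp_all)
    moreover have "q (relator S t) \<le> nrm A (poly_eval A u (relator S t))"
      using q free unfolding seminorms_def 1 by blast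
    ultimately show ?thesis by (simp only: An.q_zero)
  next
    case 2
    have "poly_eval B v (relator S t) = \<zero>\<^bsub>B\<^esub>"
    proof (rule B.poly_eval_magic_relation[OF S[unfolded 2] _ _ v_closed])
      show "v a \<otimes>\<^bsub>B\<^esub> v a = v a" if "a \<in> K2 \<times> K2" for a
        using magic_B that by (auto simp: magic_unitary_def)
      show "(\<Oplus>\<^bsub>B\<^esub>k\<in>K2. v (i, k)) = \<one>\<^bsub>B\<^esub>" "(\<Oplus>\<^bsub>B\<^esub>k\<in>K2. v (k, i)) = \<one>\<^bsub>B\<^esub>" if "i \<in> K2" for i
        using magic_B that v_sum[of "fund_rep H (i - fund_dim G)"]
          v_sum[of "\<lambda>k. fund_rep H k (i - fund_dim G)"]
        by (auto simp: magic_unitary_def)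
    qed (use comm_monoid.m_comm[OF cring.axioms(2)[OF cring_H]] in simp_all)
    moreover have "q (relator S t) \<le> nrm B (poly_eval B v (relator S t))"
      using q free unfolding seminorms_def 2 by blast
    ultimately show ?thesis by (simp only: Bn.q_zero)
  qed
qed

section \<open>Pulling a tracial state back to words\<close>

context
  fixes \<tau> :: "(nat \<Rightarrow> letter list \<Rightarrow> complex) set \<Rightarrow> complex"
  assumes tau: "tracial_state (cstar_completion FP p) \<tau>"
begin

definition \<sigma> :: "(letter list \<Rightarrow> complex) \<Rightarrow> complex" where
  "\<sigma> f = \<tau> (completion_embed FP p f)"

definition \<omega> :: "letter list \<Rightarrow> complex" where
  "\<omega> w = \<sigma> (point_fun w)"

lemma tracial_state_\<sigma>: "tracial_state FP \<sigma>"
proof -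
  let ?E = "completion_embed FP p" and ?C = "cstar_completion FP p"
  have E: "\<And>x. x \<in> carrier FP \<Longrightarrow> ?E x \<in> carrier ?C"
    "\<And>x y. \<lbrakk>x \<in> carrier FP; y \<in> carrier FP\<rbrakk> \<Longrightarrow> ?E (x \<otimes>\<^bsub>FP\<^esub> y) = ?E x \<otimes>\<^bsub>?C\<^esub> ?E y"
    "\<And>x y. \<lbrakk>x \<in> carrier FP; y \<in> carrier FP\<rbrakk> \<Longrightarrow> ?E (x \<oplus>\<^bsub>FP\<^esub> y) = ?E x \<oplus>\<^bsub>?C\<^esub> ?E y"
    "\<And>c x. x \<in> carrier FP \<Longrightarrow> ?E (c \<odot>\<^bsub>FP\<^esub> x) = c \<odot>\<^bsub>?C\<^esub> ?E x"
    "\<And>x. x \<in> carrier FP \<Longrightarrow> ?E (star FP x) = star ?C (?E x)"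
    "?E \<one>\<^bsub>FP\<^esub> = \<one>\<^bsub>?C\<^esub>"
    using FP.completion_embed_hom unfolding star_hom_def ring_hom_def by auto
  show ?thesis
    using tau unfolding tracial_state_def \<sigma>_def by (simp add: E words.F_closed)
qed

lemma \<sigma>_lin: "f \<in> carrier FP \<Longrightarrow> \<sigma> f = lin \<omega> f"
  unfolding \<omega>_def using tracial_state_\<sigma>
  by (intro words.linear_eq_lin) (auto simp: tracial_state_def)

text \<open>The completion identifies \<open>f\<close> with zero, where the pulled-back functional
  vanishes by linearity.\<close>

lemma \<sigma>_null: "f \<in> carrier FP \<Longrightarrow> p f = 0 \<Longrightarrow> \<sigma> f = 0"
  using FP.completion_embed_null[of f] \<sigma>_lin[OF FP.zero_closed]
  by (simp add: \<sigma>_def words.lin_zero)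

text \<open>By submultiplicativity the elements of seminorm zero form a two-sided ideal, so a
  relator stays null between arbitrary words \<open>x\<close> and \<open>y\<close>. Evaluating the
  functional there gives the relation in context.\<close>

lemma relator_sum:
  assumes K: "K \<in> {K1, K2}" and rel: "magic_relation K S t"
    and x: "x \<in> lists L" and y: "y \<in> lists L"
  shows "(\<Sum>w\<in>S. \<omega> (x @ w @ y)) = \<omega> (x @ t @ y)"
proof -
  let ?r = "relator S t" and ?x = "point_fun x" and ?y = "point_fun y"
  note words = magic_relation_words[OF rel]
  note null = p_magic_relation[OF K rel]
  have "lists (K \<times> K) \<subseteq> lists L" using K by (intro lists_mono) auto
  then have S: "finite S" "S \<subseteq> lists L" "t \<in> lists L" "t \<notin> S"
    using K words by auto
  have c: "?r \<in> carrier FP" "?x \<in> carrier FP" "?y \<in> carrier FP"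
    using S x y by (auto intro: relator_in_FP words.point_closed)
  have "p (?x \<otimes>\<^bsub>FP\<^esub> ?r) \<le> 0"
    using FP.q_mult[OF c(2,1)] null by simp
  then have "p (?x \<otimes>\<^bsub>FP\<^esub> ?r) = 0"
    using FP.q_nonneg[OF words.mult_closed_F[OF c(2,1)]] by simp
  then have "p (?x \<otimes>\<^bsub>FP\<^esub> ?r \<otimes>\<^bsub>FP\<^esub> ?y) \<le> 0"
    using FP.q_mult[of "?x \<otimes>\<^bsub>FP\<^esub> ?r" ?y] c by (simp add: words.F_closed)
  then have "p (?x \<otimes>\<^bsub>FP\<^esub> ?r \<otimes>\<^bsub>FP\<^esub> ?y) = 0"
    using FP.q_nonneg[of "?x \<otimes>\<^bsub>FP\<^esub> ?r \<otimes>\<^bsub>FP\<^esub> ?y"] c by (simp add: words.F_closed)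
  then have "lin \<omega> (?x \<otimes>\<^bsub>FP\<^esub> ?r \<otimes>\<^bsub>FP\<^esub> ?y) = 0"
    using \<sigma>_null[of "?x \<otimes>\<^bsub>FP\<^esub> ?r \<otimes>\<^bsub>FP\<^esub> ?y"] c by (simp add: \<sigma>_lin words.F_closed)
  also have "lin \<omega> (?x \<otimes>\<^bsub>FP\<^esub> ?r \<otimes>\<^bsub>FP\<^esub> ?y) = lin (\<lambda>z. \<omega> ((x @ z) @ y)) ?r"
    using c by (simp add: words.F_closed words.lin_F)
  finally show ?thesis using S by (simp add: lin_relator)
qed

lemma tracial_words_\<omega>: "tracial_words (fund_dim G + fund_dim H) K1 K2 \<omega>"
proof
  show "K1 \<inter> K2 = {}" "K1 \<union> K2 = {..<fund_dim G + fund_dim H}" by auto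
  show "\<omega> [] = 1"
    using tracial_state_\<sigma> by (simp add: tracial_state_def \<omega>_def words.one_F)
  show "\<omega> (x @ y) = \<omega> (y @ x)" if "x \<in> lists L" "y \<in> lists L" for x y
    using tracial_state_\<sigma> that words.point_closed[of x] words.point_closed[of y]
    by (simp add: tracial_state_def \<omega>_def flip: words.mult_point_F)
  show "\<omega> (rev x @ x) \<in> \<real>\<^sub>\<ge>\<^sub>0" if "x \<in> lists L" for x
  proof -
    have "rev x \<in> lists L" using that by (simp add: in_lists_conv_set)
    then have "star FP (point_fun x) \<otimes>\<^bsub>FP\<^esub> point_fun x = point_fun (rev x @ x)"
      using that by (simp add: words.star_point_F words.mult_point_F)
    moreover have "\<sigma> (star FP (point_fun x) \<otimes>\<^bsub>FP\<^esub> point_fun x) \<in> \<real>\<^sub>\<ge>\<^sub>0"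
      using tracial_state_\<sigma> words.point_closed[OF that] by (simp add: tracial_state_def)
    ultimately show ?thesis by (simp add: \<omega>_def)
  qed
next
  fix K a b i and x y :: "letter list"
  assume K: "K \<in> {K1, K2}" and x: "x \<in> lists L" and y: "y \<in> lists L"
  note sum = relator_sum[OF K _ x y]
  \<comment> \<open>The commutation relation exists only for distinct letters; for equal ones the
    claim is trivial.\<close>
  show "\<omega> (x @ a # b # y) = \<omega> (x @ b # a # y)" if "a \<in> K \<times> K" "b \<in> K \<times> K"
    using sum[OF magic_relation.commute[OF that]] by (cases "a = b") auto
  show "\<omega> (x @ a # a # y) = \<omega> (x @ a # y)" if "a \<in> K \<times> K"
    using sum[OF magic_relation.idem[OF that]] by simp
  show "(\<Sum>k\<in>K. \<omega> (x @ (i, k) # y)) = \<omega> (x @ y)" if "i \<in> K"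
    using sum[OF magic_relation.row[OF that]] by (simp add: sum.reindex inj_on_def)
  show "(\<Sum>k\<in>K. \<omega> (x @ (k, i) # y)) = \<omega> (x @ y)" if "i \<in> K"
    using sum[OF magic_relation.col[OF that]] by (simp add: sum.reindex inj_on_def)
qed

lemma trace_correlation_free_product:
  "trace_correlation (free_product G H) \<tau> l k i j =
     (if (i, l) \<in> L \<and> (j, k) \<in> L then \<omega> [(i, l), (j, k)] else 0)"
proof -
  let ?C = "cstar_completion FP p"
  \<comment> \<open>Lifts every entry of the block matrix, including the zero entries off the
    blocks, to the free algebra, so that one computation covers all index combinations.\<close>
  define W where "W a = (if a \<in> L then point_fun [a] else \<zero>\<^bsub>FP\<^esub>)" for a
  have W: "W a \<in> carrier FP" for a
    using words.point_closed[of "[a]"] FP.zero_closed by (auto simp: W_def)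
  have zero: "\<zero>\<^bsub>?C\<^esub> = completion_embed FP p \<zero>\<^bsub>FP\<^esub>"
    by (simp add: cstar_completion_def completion_embed_def)
  have rep: "fund_rep (free_product G H) i l = completion_embed FP p (W (i, l))" for i l
    by (simp add: free_product_def Let_def left_letters_def right_letters_def W_def zero)
  have "trace_correlation (free_product G H) \<tau> l k i j = \<sigma> (W (i, l) \<otimes>\<^bsub>FP\<^esub> W (j, k))"
    using FP.completion_embed_hom W
    by (simp add: trace_correlation_def rep \<sigma>_def star_hom_def ring_hom_def)
      (simp add: free_product_def Let_def)
  also have "\<dots> = lin (\<lambda>x. lin (\<lambda>y. \<omega> (x @ y)) (W (j, k))) (W (i, l))"
    using W by (simp add: \<sigma>_lin words.F_closed words.lin_mult_F)
  also have "\<dots> = (if (i, l) \<in> L \<and> (j, k) \<in> L then \<omega> [(i, l), (j, k)] else 0)"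
    by (simp add: W_def lin_point_fun words.lin_zero)
  finally show ?thesis .
qed

lemma local_correlation_free_product:
  "local_correlation (fund_dim (free_product G H)) (trace_correlation (free_product G H) \<tau>)"
proof -
  have "trace_correlation (free_product G H) \<tau> =
      (\<lambda>l k i j. if (i, l) \<in> L \<and> (j, k) \<in> L then \<omega> [(i, l), (j, k)] else 0)"
    by (intro ext trace_correlation_free_product)
  then show ?thesis
    using tracial_words.local_correlation_words[OF tracial_words_\<omega>]
    by (simp add: free_product_def Let_def)
qed

end

end

theorem proposition5p3:
  fixes G :: "'a matrix_qgroup" and H :: "'b matrix_qgroup"
  assumes "quantum_permutation_group G" and "quantum_permutation_group H"
    and "cring (fun_alg G)" and "cring (fun_alg H)"
  shows "\<not> has_nonlocal_symmetry (free_product G H)"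
proof -
  interpret commutative_free_product G H
    by (intro commutative_free_product.intro assms)
  have "tracial_state (cstar_completion FP p) \<tau>"
    if "tracial_state (fun_alg (free_product G H)) \<tau>" for \<tau>
    using that by (simp add: free_product_def Let_def)
  then show ?thesis
    using local_correlation_free_product unfolding has_nonlocal_symmetry_def by blast
qed

end
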